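(* Let $W$ be a Weyl tensor of type IM$^\infty$, with eigenvalues $\rho_1,\rho_2,\rho_3$ labelled so that $\rho_1=0$, and orthonormal frame $\{\mathcal U_i\}$ of self-dual eigenbivectors, so that $\mathcal W=-\sum_{i}\rho_i\,\mathcal U_i\otimes\mathcal U_i$. Put $t=|\rho_2|^2=|\rho_3|^2$, $\Pi_i=\mathcal U_i\cdot\overline{\mathcal U}_i$, $\Pi_{jk}=\mathcal U_j\cdot\overline{\mathcal U}_k$. Then the Bel-Robinson tensor $T$ of $W$ admits the canonical expression $$T=t\,(\Pi_2\otimes\Pi_2+\Pi_3\otimes\Pi_3-\Pi_{23}\otimes\Pi_{23}-\Pi_{32}\otimes\Pi_{32}).$$ The eigenvalues $\pm t$ are double and are associated with the eigenplanes $S_+=\langle\Pi_2,\Pi_3\rangle$ and $S_-=\langle\Pi_{23},\Pi_{32}\rangle$, respectively. The five-dimensional eigenspace $S_0=\langle\Pi_1,\Pi_{12},\Pi_{21},\Pi_{13},\Pi_{31}\rangle$ is associated with a vanishing eigenvalue.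
   Context: $(V,g)$ is an oriented 4-dimensional real vector space with a Lorentzian metric of signature $(-,+,+,+)$ (the tangent space of a space-time at a point); indices are moved with $g$; $\eta$ is the metric volume element; $( *F)_{\alpha\beta}=\frac12\eta_{\alpha\beta\mu\nu}F^{\mu\nu}$, $( *W)_{\alpha\beta\mu\nu}=\frac12\eta_{\alpha\beta}{}^{\rho\sigma}W_{\rho\sigma\mu\nu}$. A self-dual (SD) bivector is a complex 2-form $\mathcal F$ with $*\mathcal F=\mathrm i\mathcal F$; these form a complex 3-dimensional space with metric $\mathcal G(\mathcal F,\mathcal H)=\frac12\mathcal F_{\alpha\beta}\mathcal H^{\alpha\beta}$. A frame $\{\mathcal U_i\}$ of SD bivectors is orthonormal if $\mathcal G(\mathcal U_i,\mathcal U_j)=-\delta_{ij}$. A Weyl tensor $W$ is a real 4-tensor with the algebraic symmetries of a Riemann tensor and vanishing traces; $\mathcal W=\frac12(W-\mathrm i*W)$ acts on SD bivectors by $\mathcal W(\mathcal F)_{\alpha\beta}=\frac12\mathcal W_{\alpha\beta}{}^{\mu\nu}\mathcal F_{\mu\nu}$, with eigenvalues $\rho_i$, $\sum\rho_i=0$. Put $a=\operatorname{Tr}\mathcal W^2=\sum\rho_i^2$, $b=\operatorname{Tr}\mathcal W^3=\sum\rho_i^3=3\rho_1\rho_2\rho_3$. $W$ is of type IM$^\infty$ if $b=0$ and $a\neq0$ (the invariant $M=a^3/b^2-6$ is infinite); then the $\rho_i$ are distinct and one of them vanishes. The Bel-Robinson (BR) tensor of $W$ is $T_{\alpha\mu\beta\nu}=\mathcal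 W_{\alpha}{}^{\rho}{}_{\beta}{}^{\sigma}\,\overline{\mathcal W}_{\mu\rho\nu\sigma}$; it is totally symmetric and traceless and acts on the (complexified) 9-dimensional space of traceless symmetric 2-tensors by $T(A)_{\alpha\beta}=T_{\alpha\beta}{}^{\mu\nu}A_{\mu\nu}$. For 2-tensors $(A\cdot B)_{\alpha\beta}=A_{\alpha}{}^{\mu}B_{\mu\beta}$. $\langle\cdot\rangle$ denotes (complex) linear span. *)

theory Defs
  imports "HOL-Analysis.Analysis"
begin

text \<open>
  The vector space is real^4 with its standard orientation and an arbitrary Lorentzian metric,
  given by its Gram matrix. Equivalently, all tensors are given by their covariant components in
  an arbitrary positively oriented, not necessarily orthonormal, basis.
  Since the metric is arbitrary, this loses no generality.
\<close>

definition minkowski :: "real^4^4" where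
  "minkowski = (\<chi> \<alpha> \<beta>. if \<alpha> = \<beta> then (if \<alpha> = 1 then - 1 else 1) else 0)"

definition lorentzian :: "real^4^4 \<Rightarrow> bool" where
  "lorentzian g \<longleftrightarrow> (\<exists>P. invertible P \<and> transpose P ** g ** P = minkowski)"

definition volume_element :: "real^4^4 \<Rightarrow> 4 \<Rightarrow> 4 \<Rightarrow> 4 \<Rightarrow> 4 \<Rightarrow> real" where
  "volume_element g \<alpha> \<beta> \<mu> \<nu> =
     sqrt \<bar>det g\<bar> * det (vector [axis \<alpha> 1, axis \<beta> 1, axis \<mu> 1, axis \<nu> 1] :: real^4^4)"

text \<open>
  Complex 2-tensors form a complex vector space; the scalar multiplication provided by the library
  for this type is only the real one.
\<close>

definition cscale :: "complex \<Rightarrow> complex^4^4 \<Rightarrow> complex^4^4" where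
  "cscale c A = (\<chi> \<alpha> \<beta>. c * A $ \<alpha> $ \<beta>)"

interpretation ctensor: vector_space cscale
  by unfold_locales (simp_all add: cscale_def vec_eq_iff algebra_simps)

definition raise_indices :: "real^4^4 \<Rightarrow> complex^4^4 \<Rightarrow> complex^4^4" where
  "raise_indices g F =
     (\<chi> \<mu> \<nu>. \<Sum>\<kappa>\<in>UNIV. \<Sum>\<tau>\<in>UNIV.
        of_real (matrix_inv g $ \<mu> $ \<kappa> * matrix_inv g $ \<nu> $ \<tau>) * F $ \<kappa> $ \<tau>)"

definition tensor_dot :: "real^4^4 \<Rightarrow> complex^4^4 \<Rightarrow> complex^4^4 \<Rightarrow> complex^4^4" where
  "tensor_dot g A B =
     (\<chi> \<alpha> \<beta>. \<Sum>\<kappa>\<in>UNIV. \<Sum>\<mu>\<in>UNIV.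
        A $ \<alpha> $ \<kappa> * of_real (matrix_inv g $ \<kappa> $ \<mu>) * B $ \<mu> $ \<beta>)"

definition conj_tensor :: "complex^4^4 \<Rightarrow> complex^4^4" where
  "conj_tensor A = (\<chi> \<alpha> \<beta>. cnj (A $ \<alpha> $ \<beta>))"

definition tensor_prod :: "complex^4^4 \<Rightarrow> complex^4^4 \<Rightarrow> complex^4^4^4^4" where
  "tensor_prod A B = (\<chi> \<alpha> \<beta> \<mu> \<nu>. A $ \<alpha> $ \<beta> * B $ \<mu> $ \<nu>)"

text \<open>The action of a 4-tensor on 2-tensors, without the factor 1/2 that is used for bivectors.\<close>

definition contract :: "real^4^4 \<Rightarrow> complex^4^4^4^4 \<Rightarrow> complex^4^4 \<Rightarrow> complex^4^4" where
  "contract g X A =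
     (\<chi> \<alpha> \<beta>. \<Sum>\<mu>\<in>UNIV. \<Sum>\<nu>\<in>UNIV. X $ \<alpha> $ \<beta> $ \<mu> $ \<nu> * raise_indices g A $ \<mu> $ \<nu>)"

definition dual_bivector :: "real^4^4 \<Rightarrow> complex^4^4 \<Rightarrow> complex^4^4" where
  "dual_bivector g F =
     (\<chi> \<alpha> \<beta>. 1/2 * (\<Sum>\<mu>\<in>UNIV. \<Sum>\<nu>\<in>UNIV.
        of_real (volume_element g \<alpha> \<beta> \<mu> \<nu>) * raise_indices g F $ \<mu> $ \<nu>))"

definition sd_bivectors :: "real^4^4 \<Rightarrow> (complex^4^4) set" where
  "sd_bivectors g = {F. transpose F = - F \<and> dual_bivector g F = cscale \<i> F}"

definition bivector_metric :: "real^4^4 \<Rightarrow> complex^4^4 \<Rightarrow> complex^4^4 \<Rightarrow> complex" where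
  "bivector_metric g F H =
     1/2 * (\<Sum>\<alpha>\<in>UNIV. \<Sum>\<beta>\<in>UNIV. F $ \<alpha> $ \<beta> * raise_indices g H $ \<alpha> $ \<beta>)"

text \<open>Linear independence of the frame follows from orthonormality.\<close>

definition orthonormal_sd_frame :: "real^4^4 \<Rightarrow> (3 \<Rightarrow> complex^4^4) \<Rightarrow> bool" where
  "orthonormal_sd_frame g U \<longleftrightarrow>
     ctensor.span (range U) = sd_bivectors g \<and>
     (\<forall>i j. bivector_metric g (U i) (U j) = (if i = j then - 1 else 0))"

definition weyl_tensor :: "real^4^4 \<Rightarrow> real^4^4^4^4 \<Rightarrow> bool" where
  "weyl_tensor g W \<longleftrightarrow>
     (\<forall>\<alpha> \<beta> \<mu> \<nu>. W $ \<alpha> $ \<beta> $ \<mu> $ \<nu> = - W $ \<beta> $ \<alpha> $ \<mu> $ \<nu>) \<and>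
     (\<forall>\<alpha> \<beta> \<mu> \<nu>. W $ \<alpha> $ \<beta> $ \<mu> $ \<nu> = - W $ \<alpha> $ \<beta> $ \<nu> $ \<mu>) \<and>
     (\<forall>\<alpha> \<beta> \<mu> \<nu>. W $ \<alpha> $ \<beta> $ \<mu> $ \<nu> = W $ \<mu> $ \<nu> $ \<alpha> $ \<beta>) \<and>
     (\<forall>\<alpha> \<beta> \<mu> \<nu>. W $ \<alpha> $ \<beta> $ \<mu> $ \<nu> + W $ \<alpha> $ \<mu> $ \<nu> $ \<beta> + W $ \<alpha> $ \<nu> $ \<beta> $ \<mu> = 0) \<and>
     (\<forall>\<beta> \<nu>. (\<Sum>\<alpha>\<in>UNIV. \<Sum>\<mu>\<in>UNIV. matrix_inv g $ \<alpha> $ \<mu> * W $ \<alpha> $ \<beta> $ \<mu> $ \<nu>) = 0)"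

definition dual_weyl :: "real^4^4 \<Rightarrow> real^4^4^4^4 \<Rightarrow> real^4^4^4^4" where
  "dual_weyl g W =
     (\<chi> \<alpha> \<beta> \<mu> \<nu>. 1/2 * (\<Sum>\<kappa>\<in>UNIV. \<Sum>\<tau>\<in>UNIV. \<Sum>\<rho>\<in>UNIV. \<Sum>\<sigma>\<in>UNIV.
        volume_element g \<alpha> \<beta> \<kappa> \<tau> * matrix_inv g $ \<kappa> $ \<rho> * matrix_inv g $ \<tau> $ \<sigma> *
        W $ \<rho> $ \<sigma> $ \<mu> $ \<nu>))"

definition sd_weyl :: "real^4^4 \<Rightarrow> real^4^4^4^4 \<Rightarrow> complex^4^4^4^4" where
  "sd_weyl g W =
     (\<chi> \<alpha> \<beta> \<mu> \<nu>. 1/2 * (of_real (W $ \<alpha> $ \<beta> $ \<mu> $ \<nu>)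
        - \<i> * of_real (dual_weyl g W $ \<alpha> $ \<beta> $ \<mu> $ \<nu>)))"

definition weyl_map :: "real^4^4 \<Rightarrow> real^4^4^4^4 \<Rightarrow> complex^4^4 \<Rightarrow> complex^4^4" where
  "weyl_map g W F = cscale (1/2) (contract g (sd_weyl g W) F)"

text \<open>
  The trace of the restriction of a linear map to an invariant subspace: the sum of the diagonal
  entries of its matrix in some basis of the subspace.
\<close>

definition trace_on :: "(complex^4^4) set \<Rightarrow> (complex^4^4 \<Rightarrow> complex^4^4) \<Rightarrow> complex" where
  "trace_on S L =
     (let B = (SOME B. ctensor.independent B \<and> ctensor.span B = S)
      in \<Sum>F\<in>B. ctensor.representation B (L F) F)"

definition type_IM_infinity :: "real^4^4 \<Rightarrow> real^4^4^4^4 \<Rightarrow> bool" where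
  "type_IM_infinity g W \<longleftrightarrow>
     trace_on (sd_bivectors g) (weyl_map g W ^^ 3) = 0 \<and>
     trace_on (sd_bivectors g) (weyl_map g W ^^ 2) \<noteq> 0"

definition bel_robinson :: "real^4^4 \<Rightarrow> real^4^4^4^4 \<Rightarrow> complex^4^4^4^4" where
  "bel_robinson g W =
     (\<chi> \<alpha> \<mu> \<beta> \<nu>. \<Sum>\<kappa>\<in>UNIV. \<Sum>\<tau>\<in>UNIV. \<Sum>\<rho>\<in>UNIV. \<Sum>\<sigma>\<in>UNIV.
        sd_weyl g W $ \<alpha> $ \<kappa> $ \<beta> $ \<tau> *
        of_real (matrix_inv g $ \<kappa> $ \<rho> * matrix_inv g $ \<tau> $ \<sigma>) *
        cnj (sd_weyl g W $ \<mu> $ \<rho> $ \<nu> $ \<sigma>))"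

definition traceless_symmetric :: "real^4^4 \<Rightarrow> (complex^4^4) set" where
  "traceless_symmetric g =
     {A. transpose A = A \<and>
         (\<Sum>\<alpha>\<in>UNIV. \<Sum>\<beta>\<in>UNIV. of_real (matrix_inv g $ \<alpha> $ \<beta>) * A $ \<alpha> $ \<beta>) = 0}"

definition br_eigenspace :: "real^4^4 \<Rightarrow> real^4^4^4^4 \<Rightarrow> complex \<Rightarrow> (complex^4^4) set" where
  "br_eigenspace g W c =
     {A \<in> traceless_symmetric g. contract g (bel_robinson g W) A = cscale c A}"

end

theory Submission
  imports Defs
begin

text \<open>
  Lowered tensors are turned into matrices by raising one index, so that the dot product becomes the
  matrix product. The frame \<open>u\<^sub>i\<close> and its conjugate \<open>v\<^sub>i\<close> then satisfy the Clifford relations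
  \<open>u\<^sub>iu\<^sub>j + u\<^sub>ju\<^sub>i = \<delta>\<^sub>i\<^sub>j\<close>, and every \<open>u\<^sub>i\<close> commutes with every \<open>v\<^sub>j\<close>. Hence the 16 products
  \<open>1, u\<^sub>i, v\<^sub>j, u\<^sub>iv\<^sub>j\<close> are orthogonal for the trace form and form a basis of the complex 4 by 4 matrices:
  the metric, the self-dual and anti-self-dual bivectors, and the traceless symmetric tensors.

  Expanding the Weyl tensor in products of bivectors, the vanishing Ricci trace kills the mixed part
  and, with the Bianchi identity, the trace of the self-dual part. So the self-dual part is
  \<open>-\<Sum>\<rho>\<^sub>i U\<^sub>i \<otimes> U\<^sub>i\<close> with \<open>\<Sum>\<rho>\<^sub>i = 0\<close>, and the Bel-Robinson tensor is diagonal in the orthonormal basis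
  \<open>\<Pi>\<^sub>i\<^sub>j\<close>, with eigenvalues \<open>\<rho>\<^sub>i cnj \<rho>\<^sub>j\<close>.
\<close>

section \<open>Trace-orthogonal bases of complex matrices\<close>

lemma cscale_nth [simp]: "cscale c A $ i $ j = c * A $ i $ j"
  by (simp add: cscale_def)

lemma cscale_matrix_mult: "cscale c A ** B = cscale c (A ** B)" "A ** cscale c B = cscale c (A ** B)"
  by (simp_all add: vec_eq_iff matrix_matrix_mult_def sum_distrib_left mult_ac)

lemma matrix_add_mult: "(A + B) ** C = A ** C + B ** C" for A :: "complex^4^4"
  by (simp add: vec_eq_iff matrix_matrix_mult_def distrib_right sum.distrib)

lemma matrix_mult_sum_left: "(\<Sum>i\<in>I. A i) ** B = (\<Sum>i\<in>I. A i ** B)"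
  for A :: "'i \<Rightarrow> complex^4^4"
  by (induction I rule: infinite_finite_induct) (simp_all add: matrix_add_mult)

lemma matrix_mult_minus: "(- A) ** B = - (A ** B)" "A ** (- B) = - (A ** B)"
  for A B :: "complex^4^4"
  by (simp_all add: vec_eq_iff matrix_matrix_mult_def sum_negf)

lemma trace_cscale: "trace (cscale c A) = c * trace A"
  by (simp add: trace_def sum_distrib_left)

lemma trace_zero: "trace (0 :: complex^4^4) = 0"
  by (simp add: trace_def)

lemma trace_sum: "trace (\<Sum>i\<in>I. A i) = (\<Sum>i\<in>I. trace (A i))"
  for A :: "'i \<Rightarrow> complex^4^4"
  by (induction I rule: infinite_finite_induct) (simp_all add: trace_add trace_zero)

lemma trace_minus: "trace (- A) = - trace A" for A :: "complex^4^4"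
  by (simp add: trace_def sum_negf)

lemma trace_transpose: "trace (transpose A) = trace A"
  by (simp add: trace_def transpose_def)

lemma transpose_add: "transpose (A + B) = transpose A + transpose B"
  by (simp add: vec_eq_iff transpose_def)

lemma transpose_cscale: "transpose (cscale c A) = cscale c (transpose A)"
  by (simp add: vec_eq_iff transpose_def)

lemma matrix_zero_mult: "(0 :: complex^4^4) ** A = (0 :: complex^4^4)"
  by (simp add: vec_eq_iff matrix_matrix_mult_def)

lemma commute_mult:
  fixes A B C :: "complex^4^4"
  assumes "A ** B = B ** A" "A ** C = C ** A"
  shows "A ** (B ** C) = B ** C ** A"
proof -
  have "A ** (B ** C) = (A ** B) ** C" by (simp only: matrix_mul_assoc)
  also have "\<dots> = B ** (A ** C)" by (simp only: assms(1) matrix_mul_assoc)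
  also have "\<dots> = B ** C ** A" by (simp only: assms(2) matrix_mul_assoc)
  finally show ?thesis .
qed

text \<open>The 16 matrix units span. The bound is what later turns 16 independent matrices into a
  spanning set.\<close>

lemma complex_matrix_dim_bound:
  assumes "ctensor.independent S"
  shows "finite S \<and> card S \<le> 16"
proof -
  define T where "T = range (\<lambda>(i, j). \<chi> k l. if k = i \<and> l = j then 1 else 0 :: complex^4^4)"
  have T: "finite T" by (simp add: T_def)
  have "A \<in> ctensor.span T" for A
  proof -
    have "A = (\<Sum>(i, j)\<in>UNIV. cscale (A $ i $ j) (\<chi> k l. if k = i \<and> l = j then 1 else 0))"
    proof -
      have "(\<Sum>p\<in>UNIV. case p of (i, j) \<Rightarrow> cscale (A $ i $ j) (\<chi> k l. if k = i \<and> l = j then 1 else 0)) $ m $ n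
        = (\<Sum>p\<in>UNIV. if p = (m, n) then A $ m $ n else 0)" for m n
        unfolding sum_component by (rule sum.cong) (auto split: if_splits)
      then show ?thesis by (simp add: vec_eq_iff)
    qed
    moreover have "(\<Sum>(i, j)\<in>UNIV. cscale (A $ i $ j) (\<chi> k l. if k = i \<and> l = j then 1 else 0)) \<in> ctensor.span T"
    proof (rule ctensor.span_sum)
      fix p :: "4 \<times> 4"
      show "(case p of (i, j) \<Rightarrow> cscale (A $ i $ j) (\<chi> k l. if k = i \<and> l = j then 1 else 0))
          \<in> ctensor.span T"
        by (cases p) (auto simp: T_def intro!: ctensor.span_scale[OF ctensor.span_base] rangeI)
    qed
    ultimately show ?thesis by simp
  qed
  then have "finite S \<and> card S \<le> card T"
    using ctensor.independent_span_bound[OF T assms] by blast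
  moreover have "card T \<le> 16"
    unfolding T_def using card_image_le[of "UNIV :: (4 \<times> 4) set"] by (simp add: card_UNIV_unit)
  ultimately show ?thesis by linarith
qed

text \<open>The option type adjoins the identity to a family of generators, so that pairs of options
  index the 16 products of at most one \<open>u\<close> and at most one \<open>v\<close>.\<close>

definition unital :: "(3 \<Rightarrow> complex^4^4) \<Rightarrow> 3 option \<Rightarrow> complex^4^4" where
  "unital w a = (case a of None \<Rightarrow> mat 1 | Some i \<Rightarrow> w i)"

lemma unital_simps [simp]: "unital w None = mat 1" "unital w (Some i) = w i"
  by (simp_all add: unital_def)

section \<open>Two commuting Clifford families and their trace form\<close>

locale clifford_pair =
  fixes u v :: "3 \<Rightarrow> complex^4^4"
  assumes u_anticommute: "u i ** u j + u j ** u i = (if i = j then mat 1 else 0)"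
    and v_anticommute: "v i ** v j + v j ** v i = (if i = j then mat 1 else 0)"
    and uv_commute: "u i ** v j = v j ** u i"
begin

text \<open>The two families play symmetric roles, so every fact about \<open>u\<close> transfers to
  \<open>v\<close>.\<close>

lemma swapped: "clifford_pair v u"
  by unfold_locales (simp_all add: u_anticommute v_anticommute uv_commute)

lemma u_square: "u i ** u i = cscale (1/2) (mat 1)"
proof -
  have "u i ** u i + u i ** u i = mat 1" using u_anticommute[of i i] by simp
  then have "2 * (u i ** u i) $ k $ l = mat 1 $ k $ l" for k l
    by (metis mult_2 vector_add_component)
  then show ?thesis by (simp add: vec_eq_iff field_simps)
qed

lemma u_swap: "i \<noteq> j \<Longrightarrow> u i ** u j = - (u j ** u i)"
  using u_anticommute[of i j] by (simp add: eq_neg_iff_add_eq_0)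

text \<open>By cyclicity and \<open>u_square\<close>, the trace of \<open>u i ** X ** u i\<close> is
  half the trace of \<open>X\<close>; moving \<open>u i\<close> through \<open>X\<close> instead
  gives minus that half.\<close>

lemma trace_eq_0_if_anticommutes:
  assumes "u i ** X = - (X ** u i)"
  shows "trace X = 0"
proof -
  have *: "trace (u i ** Y ** u i) = trace Y / 2" for Y
  proof -
    have "trace (u i ** Y ** u i) = trace (u i ** u i ** Y)"
      by (simp add: trace_mul_sym[of "u i ** Y"] matrix_mul_assoc)
    then show ?thesis by (simp add: u_square cscale_matrix_mult trace_cscale)
  qed
  have "u i ** X ** u i = - (X ** (u i ** u i))"
    by (simp add: assms matrix_mult_minus matrix_mul_assoc)
  then have "trace (u i ** X ** u i) = - (trace X / 2)"
    by (simp add: u_square cscale_matrix_mult trace_minus trace_cscale)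
  with *[of X] show ?thesis by simp
qed

text \<open>Some \<open>u j\<close> anticommutes with the product of the two \<open>u\<close>
  factors. If one factor is the identity, any index different from the other one serves; if both are
  generators, the first generator itself serves. \<open>Y\<close> does not disturb this since it
  commutes with every \<open>u j\<close>.\<close>

lemma trace_distinct:
  assumes "a \<noteq> c" and Y: "\<And>j. u j ** Y = Y ** u j"
  shows "trace (unital u a ** unital u c ** Y) = 0"
proof -
  have "\<exists>j. u j ** (unital u a ** unital u c) = - (unital u a ** unital u c ** u j)"
  proof (cases a)
    case None
    then obtain i where i: "c = Some i" using assms(1) by (cases c) auto
    obtain j where "j \<noteq> i" by (metis zero_neq_one)
    then show ?thesis using None i u_swap[of j i] by auto
  next
    case (Some i)
    show ?thesis
    proof (cases c)
      case None
      obtain j where "j \<noteq> i" by (metis zero_neq_one)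
      then show ?thesis using None Some u_swap[of j i] by auto
    next
      case (Some k)
      then have "u i ** (u i ** u k) = - (u i ** u k ** u i)"
        using \<open>a = Some i\<close> assms(1) u_swap[of i k]
        by (metis matrix_mul_assoc matrix_mult_minus(2))
      then show ?thesis using Some \<open>a = Some i\<close> by auto
    qed
  qed
  then obtain j where j: "u j ** (unital u a ** unital u c) = - (unital u a ** unital u c ** u j)"
    by blast
  have "u j ** (unital u a ** unital u c ** Y) = - (unital u a ** unital u c ** u j) ** Y"
    by (simp only: matrix_mul_assoc[of "u j" "unital u a ** unital u c" Y] j)
  also have "\<dots> = - (unital u a ** unital u c ** Y ** u j)"
    by (simp only: matrix_mult_minus matrix_mul_assoc[symmetric] Y)
  finally have "u j ** (unital u a ** unital u c ** Y) = - (unital u a ** unital u c ** Y ** u j)" .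
  then show ?thesis by (rule trace_eq_0_if_anticommutes)
qed

lemma unital_commute: "unital u a ** unital v b = unital v b ** unital u a"
  by (cases a; cases b) (simp_all add: uv_commute)

definition E :: "3 option \<times> 3 option \<Rightarrow> complex^4^4" where
  "E p = unital u (fst p) ** unital v (snd p)"

text \<open>This is the trace of the square of \<open>E p\<close>: 4 for the identity, with a factor
  1/2 from the square of each generator.\<close>

definition weight :: "3 option \<times> 3 option \<Rightarrow> complex" where
  "weight p = 4 * (if fst p = None then 1 else 1/2) * (if snd p = None then 1 else 1/2)"

lemma weight_nonzero: "weight p \<noteq> 0"
  by (simp add: weight_def)

lemma unital_u_square: "unital u a ** unital u a = cscale (if a = None then 1 else 1/2) (mat 1)"
  by (cases a) (simp_all add: u_square)

lemma E_mult: "E p ** E q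
    = unital u (fst p) ** unital u (fst q) ** (unital v (snd p) ** unital v (snd q))"
  unfolding E_def by (metis matrix_mul_assoc unital_commute)

text \<open>If the first indices differ, the \<open>v\<close> part commutes with every
  \<open>u\<close> and \<open>trace_distinct\<close> applies. If the second indices differ, cycling
  the trace gives the same situation for the swapped pair.\<close>

lemma trace_E_mult: "trace (E p ** E q) = (if p = q then weight p else 0)"
proof -
  interpret s: clifford_pair v u by (rule swapped)
  obtain a b c d where pq: "p = (a, b)" "q = (c, d)" by fastforce
  consider "a \<noteq> c" | "b \<noteq> d" | "a = c" "b = d" by blast
  then show ?thesis
  proof cases
    case 1
    have "u j ** (unital v b ** unital v d) = unital v b ** unital v d ** u j" for j
      by (metis matrix_mul_assoc unital_commute unital_simps(2))
    with 1 show ?thesis by (simp add: E_mult pq trace_distinct)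
  next
    case 2
    have "v j ** (unital u a ** unital u c) = unital u a ** unital u c ** v j" for j
      by (metis matrix_mul_assoc unital_commute unital_simps(2))
    moreover have "trace (E p ** E q) = trace (unital v b ** unital v d ** (unital u a ** unital u c))"
      by (simp only: E_mult pq fst_conv snd_conv trace_mul_sym[of "unital u a ** unital u c"])
    ultimately show ?thesis using 2 s.trace_distinct by (simp add: pq)
  next
    case 3
    have "unital v b ** unital v b = cscale (if b = None then 1 else 1/2) (mat 1)"
      by (rule s.unital_u_square)
    with 3 show ?thesis
      by (simp add: E_mult pq unital_u_square cscale_matrix_mult trace_cscale trace_I weight_def)
  qed
qed

lemma trace_sum_E: "trace ((\<Sum>p\<in>UNIV. cscale (c p) (E p)) ** E q) = c q * weight q"
proof -
  have "trace ((\<Sum>p\<in>UNIV. cscale (c p) (E p)) ** E q) = (\<Sum>p\<in>UNIV. if p = q then c q * weight q else 0)"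
    by (simp add: matrix_mult_sum_left cscale_matrix_mult trace_sum trace_cscale trace_E_mult
        if_distrib[where f = "(*) _"] cong: if_cong)
  then show ?thesis by simp
qed

lemma E_inj: "inj E"
  by (rule injI) (metis trace_E_mult weight_nonzero)

lemma independent_E: "ctensor.independent (range E)"
proof (rule ctensor.independent_if_scalars_zero)
  fix f x assume f: "(\<Sum>x\<in>range E. cscale (f x) x) = 0" and "x \<in> range E"
  then obtain p where p: "x = E p" by blast
  have "(\<Sum>q\<in>UNIV. cscale (f (E q)) (E q)) = 0"
    using f by (simp add: sum.reindex[OF E_inj] o_def)
  then have "f (E p) * weight p = 0"
    using trace_sum_E[of "f \<circ> E" p] by (simp add: trace_def)
  then show "f x = 0" using p weight_nonzero by simp
qed simp

text \<open>A matrix outside the span would extend the 16 independent members of \<open>E\<close> to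
  17 independent matrices.\<close>

lemma span_E: "A \<in> ctensor.span (range E)"
proof (rule ccontr)
  assume A: "A \<notin> ctensor.span (range E)"
  then have "ctensor.independent (insert A (range E))"
    by (intro ctensor.independent_insertI independent_E)
  from complex_matrix_dim_bound[OF this] have "card (insert A (range E)) \<le> 16" by simp
  moreover have "A \<notin> range E" using A ctensor.span_base by blast
  ultimately show False by (simp add: card_image[OF E_inj])
qed

lemma expansion: "A = (\<Sum>p\<in>UNIV. cscale (trace (A ** E p) / weight p) (E p))"
proof -
  obtain f where "A = (\<Sum>x\<in>range E. cscale (f x) x)"
    using span_E[of A] ctensor.span_finite[of "range E"] by auto
  then have A: "A = (\<Sum>p\<in>UNIV. cscale (f (E p)) (E p))"
    by (simp add: sum.reindex[OF E_inj] o_def)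
  then have "trace (A ** E p) = f (E p) * weight p" for p
    using trace_sum_E[of "f \<circ> E" p] by simp
  then show ?thesis using A weight_nonzero by simp
qed

text \<open>The triple product of \<open>u\<close>'s commutes with every \<open>v n\<close>, hence
  is trace-orthogonal to \<open>v k\<close>; its value is never computed. This removes the unmixed
  terms when the Ricci trace is tested against \<open>u j ** v k\<close>.\<close>

lemma trace_uuuv: "trace (u l ** u m ** (u j ** v k)) = 0"
proof -
  interpret s: clifford_pair v u by (rule swapped)
  have "v n ** (u l ** u m ** u j) = u l ** u m ** u j ** v n" for n
    by (intro commute_mult uv_commute[symmetric])
  from s.trace_distinct[of None "Some k", OF _ this]
  have "trace (v k ** (u l ** u m ** u j)) = 0" by simp
  moreover have "u l ** u m ** (u j ** v k) = u l ** u m ** u j ** v k"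
    by (simp only: matrix_mul_assoc)
  ultimately show ?thesis by (simp only: trace_mul_sym[of "u l ** u m ** u j"])
qed

lemma trace_vvuv: "trace (v l ** v m ** (u j ** v k)) = 0"
proof -
  interpret s: clifford_pair v u by (rule swapped)
  show ?thesis using s.trace_uuuv[of l m k j] by (simp only: uv_commute)
qed

lemma trace_uu: "trace (u i ** u j) = (if i = j then 2 else 0)"
  using trace_E_mult[of "(Some i, None)" "(Some j, None)"] by (simp add: E_def weight_def)

lemma trace_vv: "trace (v i ** v j) = (if i = j then 2 else 0)"
  using trace_E_mult[of "(None, Some i)" "(None, Some j)"] by (simp add: E_def weight_def)

lemma trace_uv: "trace (u i ** v j) = 0"
  using trace_E_mult[of "(Some i, None)" "(None, Some j)"] by (simp add: E_def weight_def)

lemma trace_uvuv: "trace (u i ** v j ** (u k ** v l)) = (if i = k \<and> j = l then 1 else 0)"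
  using trace_E_mult[of "(Some i, Some j)" "(Some k, Some l)"] by (simp add: E_def weight_def)

lemma trace_vuvu: "trace (v i ** u j ** (v k ** u j)) = (if i = k then 1 else 0)"
  using trace_uvuv[of j i j k] by (simp add: uv_commute)

text \<open>Conjugation by \<open>u k\<close> multiplies \<open>u j\<close> by 1/2 or -1/2 according
  to whether the indices agree. The minus sign, absent from \<open>trace_vuvu\<close>, is what lets
  the Bianchi identity tell the two families apart.\<close>

lemma trace_uuuu: "trace (u i ** u k ** (u j ** u k)) = (if i = j then if i = k then 1 else - 1 else 0)"
proof -
  have "u k ** (u j ** u k) = cscale (if j = k then 1/2 else - 1/2) (u j)"
  proof (cases "j = k")
    case True
    then show ?thesis by (simp add: u_square cscale_matrix_mult)
  next
    case False
    have "u k ** (u j ** u k) = - (u k ** u k ** u j)"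
      using u_swap[OF False] by (simp add: matrix_mult_minus matrix_mul_assoc)
    also have "\<dots> = cscale (- 1/2) (u j)"
      by (simp add: u_square cscale_matrix_mult vec_eq_iff)
    finally show ?thesis using False by simp
  qed
  then have "trace (u i ** u k ** (u j ** u k)) = trace (u i ** cscale (if j = k then 1/2 else - 1/2) (u j))"
    by (simp only: flip: matrix_mul_assoc)
  then show ?thesis by (simp add: cscale_matrix_mult trace_cscale trace_uu)
qed

end

section \<open>Normal form of self-dual bivectors\<close>

lemma vector_4 [simp]:
  "(vector [x, y, z, w] :: 'a::zero^4) $ 1 = x"
  "(vector [x, y, z, w] :: 'a::zero^4) $ 2 = y"
  "(vector [x, y, z, w] :: 'a::zero^4) $ 3 = z"
  "(vector [x, y, z, w] :: 'a::zero^4) $ 4 = w"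
  by (simp_all add: vector_def)

lemma det_4:
  fixes A :: "'a::comm_ring_1^4^4"
  shows "det A =
     A$1$1 * A$2$2 * A$3$3 * A$4$4 - A$1$1 * A$2$2 * A$3$4 * A$4$3
   - A$1$1 * A$2$3 * A$3$2 * A$4$4 + A$1$1 * A$2$3 * A$3$4 * A$4$2
   + A$1$1 * A$2$4 * A$3$2 * A$4$3 - A$1$1 * A$2$4 * A$3$3 * A$4$2
   - A$1$2 * A$2$1 * A$3$3 * A$4$4 + A$1$2 * A$2$1 * A$3$4 * A$4$3
   + A$1$2 * A$2$3 * A$3$1 * A$4$4 - A$1$2 * A$2$3 * A$3$4 * A$4$1
   - A$1$2 * A$2$4 * A$3$1 * A$4$3 + A$1$2 * A$2$4 * A$3$3 * A$4$1
   + A$1$3 * A$2$1 * A$3$2 * A$4$4 - A$1$3 * A$2$1 * A$3$4 * A$4$2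
   - A$1$3 * A$2$2 * A$3$1 * A$4$4 + A$1$3 * A$2$2 * A$3$4 * A$4$1
   + A$1$3 * A$2$4 * A$3$1 * A$4$2 - A$1$3 * A$2$4 * A$3$2 * A$4$1
   - A$1$4 * A$2$1 * A$3$2 * A$4$3 + A$1$4 * A$2$1 * A$3$3 * A$4$2
   + A$1$4 * A$2$2 * A$3$1 * A$4$3 - A$1$4 * A$2$2 * A$3$3 * A$4$1
   - A$1$4 * A$2$3 * A$3$1 * A$4$2 + A$1$4 * A$2$3 * A$3$2 * A$4$1"
proof -
  have f1234: "finite {2::4, 3, 4}" "1 \<notin> {2::4, 3, 4}" by auto
  have f234: "finite {3::4, 4}" "2 \<notin> {3::4, 4}" by auto
  have f34: "finite {4::4}" "3 \<notin> {4::4}" by auto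
  show ?thesis
    unfolding det_def UNIV_4
    unfolding sum_over_permutations_insert[OF f1234]
    unfolding sum_over_permutations_insert[OF f234]
    unfolding sum_over_permutations_insert[OF f34]
    unfolding permutes_sing
    by (simp add: sign_swap_id permutation_swap_id sign_compose permutation_compose sign_id
        transpose_def)
qed


definition permutation_symbol :: "4 \<Rightarrow> 4 \<Rightarrow> 4 \<Rightarrow> 4 \<Rightarrow> real" where
  "permutation_symbol a b c d = det (vector [axis a 1, axis b 1, axis c 1, axis d 1] :: real^4^4)"

text \<open>Linearity of the determinant in each row, in the form that lets a change of basis act on
  one index of the volume element at a time.\<close>

lemma det_vector_expand:
  fixes x y z w :: "real^4"
  shows "det (vector [x, y, z, w] :: real^4^4) = (\<Sum>i\<in>UNIV. x $ i * det (vector [axis i 1, y, z, w] :: real^4^4))"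
    "det (vector [x, y, z, w] :: real^4^4) = (\<Sum>i\<in>UNIV. y $ i * det (vector [x, axis i 1, z, w] :: real^4^4))"
    "det (vector [x, y, z, w] :: real^4^4) = (\<Sum>i\<in>UNIV. z $ i * det (vector [x, y, axis i 1, w] :: real^4^4))"
    "det (vector [x, y, z, w] :: real^4^4) = (\<Sum>i\<in>UNIV. w $ i * det (vector [x, y, z, axis i 1] :: real^4^4))"
  by (simp_all add: det_4 sum_4 axis_def algebra_simps)

text \<open>The transformation law of the volume form: the rows are those of the unit-vector matrix
  multiplied by \<open>transpose P\<close>.\<close>

lemma det_vector_columns:
  fixes P :: "real^4^4"
  shows "det (vector [column a P, column b P, column c P, column d P] :: real^4^4)
    = det P * permutation_symbol a b c d"
proof -
  have "vector [column a P, column b P, column c P, column d P]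
      = (vector [axis a 1, axis b 1, axis c 1, axis d 1] :: real^4^4) ** transpose P"
    by (simp add: vec_eq_iff forall_4 matrix_matrix_mult_def column_def transpose_def axis_def
        if_distrib[where f = "\<lambda>x. x * _"] cong: if_cong)
  then show ?thesis by (simp add: det_mul permutation_symbol_def mult.commute)
qed

section \<open>Tensor operations as matrix products\<close>

definition cmat :: "real^4^4 \<Rightarrow> complex^4^4" where
  "cmat A = (\<chi> i j. of_real (A $ i $ j))"

lemma cmat_nth [simp]: "cmat A $ i $ j = of_real (A $ i $ j)"
  by (simp add: cmat_def)

lemma cmat_mult: "cmat (A ** B) = cmat A ** cmat B"
  by (simp add: vec_eq_iff matrix_matrix_mult_def)

lemma cmat_mat: "cmat (mat 1) = mat 1"
  by (simp add: vec_eq_iff mat_def)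

lemma cmat_transpose: "cmat (transpose A) = transpose (cmat A)"
  by (simp add: vec_eq_iff transpose_def)

lemma conj_tensor_nth [simp]: "conj_tensor A $ i $ j = cnj (A $ i $ j)"
  by (simp add: conj_tensor_def)

lemma conj_tensor_cmat [simp]: "conj_tensor (cmat A) = cmat A"
  by (simp add: vec_eq_iff)

lemma conj_tensor_mult: "conj_tensor (A ** B) = conj_tensor A ** conj_tensor B"
  by (simp add: vec_eq_iff matrix_matrix_mult_def)

text \<open>The transpose stays here because \<open>g\<close> is arbitrary; symmetry of the inverse
  metric becomes available only for Lorentzian \<open>g\<close>, in
  \<open>lorentzian_inverse\<close>.\<close>

lemma raise_indices_matrix:
  "raise_indices g F = cmat (matrix_inv g) ** F ** transpose (cmat (matrix_inv g))"
  unfolding vec_eq_iff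
proof (intro allI)
  fix i j
  have "raise_indices g F $ i $ j = (\<Sum>k\<in>UNIV. \<Sum>l\<in>UNIV. cmat (matrix_inv g) $ i $ k * F $ k $ l * cmat (matrix_inv g) $ j $ l)"
    by (simp add: raise_indices_def mult_ac)
  also have "\<dots> = (\<Sum>l\<in>UNIV. \<Sum>k\<in>UNIV. cmat (matrix_inv g) $ i $ k * F $ k $ l * cmat (matrix_inv g) $ j $ l)"
    by (rule sum.swap)
  also have "\<dots> = (cmat (matrix_inv g) ** F ** transpose (cmat (matrix_inv g))) $ i $ j"
    by (simp add: matrix_matrix_mult_def transpose_def sum_distrib_right)
  finally show "raise_indices g F $ i $ j = (cmat (matrix_inv g) ** F ** transpose (cmat (matrix_inv g))) $ i $ j" .
qed

lemma tensor_dot_matrix: "tensor_dot g A B = A ** cmat (matrix_inv g) ** B"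
  unfolding vec_eq_iff
proof (intro allI)
  fix i j
  have "tensor_dot g A B $ i $ j = (\<Sum>k\<in>UNIV. \<Sum>l\<in>UNIV. A $ i $ k * cmat (matrix_inv g) $ k $ l * B $ l $ j)"
    by (simp add: tensor_dot_def)
  also have "\<dots> = (\<Sum>l\<in>UNIV. \<Sum>k\<in>UNIV. A $ i $ k * cmat (matrix_inv g) $ k $ l * B $ l $ j)"
    by (rule sum.swap)
  also have "\<dots> = (A ** cmat (matrix_inv g) ** B) $ i $ j"
    by (simp add: matrix_matrix_mult_def sum_distrib_right)
  finally show "tensor_dot g A B $ i $ j = (A ** cmat (matrix_inv g) ** B) $ i $ j" .
qed

section \<open>Oriented orthonormal bases of a Lorentzian metric\<close>

lemma det_minkowski: "det minkowski = - 1"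
  by (simp add: det_4 minkowski_def)

lemma minkowski_square: "minkowski ** minkowski = mat 1"
  by (simp add: vec_eq_iff forall_4 matrix_matrix_mult_def sum_4 minkowski_def mat_def)

lemma transpose_minkowski: "transpose minkowski = minkowski"
  by (simp add: vec_eq_iff transpose_def minkowski_def)

lemma lorentzian_oriented_frame:
  assumes "lorentzian g"
  obtains P where "det P > 0" "transpose P ** g ** P = minkowski"
proof -
  obtain P where P: "invertible P" "transpose P ** g ** P = minkowski"
    using assms by (auto simp: lorentzian_def)
  have "det P \<noteq> 0" using P(1) invertible_det_nz by blast
  then consider "det P > 0" | "det P < 0" by linarith
  then show thesis
  proof cases
    case 1
    then show ?thesis using P that by blast
  next
    case 2
    \<comment> \<open>Reversing the last, spacelike basis vector corrects the orientation and keeps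
      the Gram matrix.\<close>
    define D :: "real^4^4" where "D = (\<chi> i j. if i = j then if i = 4 then - 1 else 1 else 0)"
    have D: "transpose D ** minkowski ** D = minkowski"
      by (simp add: vec_eq_iff forall_4 matrix_matrix_mult_def transpose_def sum_4 minkowski_def D_def)
    have "det D = - 1" by (simp add: det_4 D_def)
    then have "det (P ** D) > 0" using 2 by (simp add: det_mul)
    moreover have "transpose (P ** D) ** g ** (P ** D) = transpose D ** (transpose P ** g ** P) ** D"
      by (simp only: matrix_transpose_mul matrix_mul_assoc)
    then have "transpose (P ** D) ** g ** (P ** D) = minkowski" by (simp only: D P(2))
    ultimately show ?thesis using that by blast
  qed
qed

text \<open>\<open>matrix_inv\<close> is defined by choice; uniqueness of two-sided inverses
  determines it.\<close>

lemma matrix_inv_eqI: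
  fixes A B :: "real^4^4"
  assumes "A ** B = mat 1"
  shows "matrix_inv A = B"
proof -
  have BA: "B ** A = mat 1" using assms matrix_left_right_inverse by blast
  have "A ** matrix_inv A = mat 1 \<and> matrix_inv A ** A = mat 1"
    unfolding matrix_inv_def by (rule someI[of _ B]) (simp add: assms BA)
  then show ?thesis by (metis BA matrix_mul_assoc matrix_mul_lid matrix_mul_rid)
qed

text \<open>
  Covariant components of the self-dual bivectors in a positively oriented orthonormal basis; index 1
  is timelike.
\<close>

definition sd_matrix :: "complex \<Rightarrow> complex \<Rightarrow> complex \<Rightarrow> complex^4^4" where
  "sd_matrix a b c = vector [vector [0, a, b, c], vector [- a, 0, \<i> * c, - \<i> * b],
     vector [- b, - \<i> * c, 0, \<i> * a], vector [- c, \<i> * b, - \<i> * a, 0]]"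

abbreviation cminkowski :: "complex^4^4" where
  "cminkowski \<equiv> cmat minkowski"

lemma sd_matrix_anticommute:
  "sd_matrix a b c ** cminkowski ** sd_matrix a' b' c' + sd_matrix a' b' c' ** cminkowski ** sd_matrix a b c
    = cscale (2 * (a * a' + b * b' + c * c')) cminkowski"
  by (simp add: vec_eq_iff forall_4 matrix_matrix_mult_def sum_4 sd_matrix_def minkowski_def algebra_simps)

text \<open>This reflects the splitting of the complexified Lorentz algebra into two commuting
  ideals, the self-dual and the anti-self-dual one. In an orthonormal basis it is an entrywise
  computation.\<close>

lemma sd_matrix_commute:
  "sd_matrix a b c ** cminkowski ** conj_tensor (sd_matrix a' b' c')
    = conj_tensor (sd_matrix a' b' c') ** cminkowski ** sd_matrix a b c"
  by (simp add: vec_eq_iff forall_4 matrix_matrix_mult_def sum_4 sd_matrix_def minkowski_def algebra_simps)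

lemma sd_matrix_metric:
  "trace (sd_matrix a b c ** cminkowski ** sd_matrix a' b' c' ** cminkowski)
    = 4 * (a * a' + b * b' + c * c')"
  by (simp add: trace_def matrix_matrix_mult_def sum_4 sd_matrix_def minkowski_def algebra_simps)

text \<open>Self-duality expresses the three space-space components by the three time-space ones, so
  the first row determines everything.\<close>

lemma sd_matrixI:
  assumes "transpose X = - X"
    and dual: "\<And>a b. 1/2 * (\<Sum>c\<in>UNIV. \<Sum>d\<in>UNIV.
        of_real (permutation_symbol a b c d) * (cminkowski ** X ** cminkowski) $ c $ d) = \<i> * X $ a $ b"
  shows "X = sd_matrix (X $ 1 $ 2) (X $ 1 $ 3) (X $ 1 $ 4)"
proof -
  have skew: "X $ i $ j = - X $ j $ i" for i j
    using assms(1) by (metis (no_types, lifting) transpose_def vec_lambda_beta vector_uminus_component)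
  have diag: "X $ i $ i = 0" for i
    using skew[of i i] by simp
  note [simp] = sum_4 matrix_matrix_mult_def minkowski_def permutation_symbol_def det_4 axis_def
  have "X $ 3 $ 4 = \<i> * X $ 1 $ 2" using dual[of 1 2] skew[of 4 3] by simp
  moreover have "X $ 4 $ 2 = \<i> * X $ 1 $ 3" using dual[of 1 3] skew[of 2 4] by simp
  moreover have "X $ 2 $ 3 = \<i> * X $ 1 $ 4" using dual[of 1 4] skew[of 3 2] by simp
  ultimately show ?thesis
    using skew[of 2 1] skew[of 3 1] skew[of 4 1] skew[of 3 2] skew[of 2 4] skew[of 4 3]
    by (simp add: vec_eq_iff forall_4 sd_matrix_def diag)
qed

lemma sum_swap_pairs:
  "(\<Sum>i\<in>A. \<Sum>j\<in>B. \<Sum>k\<in>C. \<Sum>l\<in>D. f i j k l) = (\<Sum>k\<in>C. \<Sum>l\<in>D. \<Sum>i\<in>A. \<Sum>j\<in>B. f i j k l)"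
proof -
  have "(\<Sum>p\<in>A \<times> B. \<Sum>q\<in>C \<times> D. f (fst p) (snd p) (fst q) (snd q))
    = (\<Sum>q\<in>C \<times> D. \<Sum>p\<in>A \<times> B. f (fst p) (snd p) (fst q) (snd q))"
    by (rule sum.swap)
  then show ?thesis by (simp only: sum.cartesian_product' fst_conv snd_conv)
qed

lemma congruence_nth:
  "(A ** X ** transpose B) $ i $ j = (\<Sum>k\<in>UNIV. \<Sum>l\<in>UNIV. A $ i $ k * B $ j $ l * X $ k $ l)"
  for A B X :: "complex^4^4"
proof -
  have "(A ** X ** transpose B) $ i $ j = (\<Sum>l\<in>UNIV. \<Sum>k\<in>UNIV. A $ i $ k * B $ j $ l * X $ k $ l)"
    by (simp add: matrix_matrix_mult_def transpose_def sum_distrib_right sum_distrib_left mult_ac)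
  also have "\<dots> = (\<Sum>k\<in>UNIV. \<Sum>l\<in>UNIV. A $ i $ k * B $ j $ l * X $ k $ l)" by (rule sum.swap)
  finally show ?thesis .
qed

text \<open>\<open>X\<close> holds the contravariant components in the basis of columns of
  \<open>P\<close>. Passing to this basis in all four indices feeds the columns of \<open>P\<close>
  into the determinant, which yields \<open>det P\<close> times the permutation symbol.
  \<open>expand2\<close> treats the contracted indices and \<open>expand1\<close> the free
  ones.\<close>

lemma dual_bivector_congruence:
  assumes "raise_indices g F = cmat P ** X ** transpose (cmat P)"
  shows "(transpose (cmat P) ** dual_bivector g F ** cmat P) $ a $ b
    = 1/2 * of_real (sqrt \<bar>det g\<bar> * det P)
      * (\<Sum>c\<in>UNIV. \<Sum>d\<in>UNIV. of_real (permutation_symbol a b c d) * X $ c $ d)"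
proof -
  define D where "D x y z w = det (vector [x, y, z, w] :: real^4^4)" for x y z w :: "real^4"
  define s where "s = sqrt \<bar>det g\<bar>"
  have expand2: "(\<Sum>m\<in>UNIV. \<Sum>n\<in>UNIV. P $ m $ c * P $ n $ d * D x y (axis m 1) (axis n 1))
      = D x y (column c P) (column d P)" for x y c d
    unfolding D_def det_vector_expand(3)[of x y "column c P" "column d P"]
      det_vector_expand(4)[of x y "axis m 1" "column d P" for m]
    by (simp add: column_def sum_distrib_left mult_ac)
  have expand1: "(\<Sum>m\<in>UNIV. \<Sum>n\<in>UNIV. P $ m $ a * P $ n $ b * D (axis m 1) (axis n 1) z w)
      = D (column a P) (column b P) z w" for z w
    unfolding D_def det_vector_expand(1)[of "column a P" "column b P" z w]
      det_vector_expand(2)[of "axis m 1" "column b P" z w for m]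
    by (simp add: column_def sum_distrib_left mult_ac)
  have dual: "dual_bivector g F $ i $ j
      = 1/2 * of_real s * (\<Sum>c\<in>UNIV. \<Sum>d\<in>UNIV. of_real (D (axis i 1) (axis j 1) (column c P) (column d P)) * X $ c $ d)"
    for i j
  proof -
    have "dual_bivector g F $ i $ j = 1/2 * of_real s * (\<Sum>m\<in>UNIV. \<Sum>n\<in>UNIV. \<Sum>c\<in>UNIV. \<Sum>d\<in>UNIV.
        of_real (P $ m $ c * P $ n $ d * D (axis i 1) (axis j 1) (axis m 1) (axis n 1)) * X $ c $ d)"
      by (simp add: dual_bivector_def assms congruence_nth volume_element_def s_def D_def
          sum_distrib_left mult_ac)
    also have "\<dots> = 1/2 * of_real s * (\<Sum>c\<in>UNIV. \<Sum>d\<in>UNIV. \<Sum>m\<in>UNIV. \<Sum>n\<in>UNIV.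
        of_real (P $ m $ c * P $ n $ d * D (axis i 1) (axis j 1) (axis m 1) (axis n 1)) * X $ c $ d)"
      by (subst sum_swap_pairs) (rule refl)
    finally show ?thesis
      by (simp only: expand2[symmetric] of_real_sum sum_distrib_right)
  qed
  have "(transpose (cmat P) ** dual_bivector g F ** cmat P) $ a $ b
      = (transpose (cmat P) ** dual_bivector g F ** transpose (transpose (cmat P))) $ a $ b"
    by simp
  also have "\<dots> = 1/2 * of_real s * (\<Sum>i\<in>UNIV. \<Sum>j\<in>UNIV. \<Sum>c\<in>UNIV. \<Sum>d\<in>UNIV.
      of_real (P $ i $ a * P $ j $ b * D (axis i 1) (axis j 1) (column c P) (column d P)) * X $ c $ d)"
    unfolding congruence_nth dual by (simp add: transpose_def sum_distrib_left mult_ac)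
  also have "\<dots> = 1/2 * of_real s * (\<Sum>c\<in>UNIV. \<Sum>d\<in>UNIV. \<Sum>i\<in>UNIV. \<Sum>j\<in>UNIV.
      of_real (P $ i $ a * P $ j $ b * D (axis i 1) (axis j 1) (column c P) (column d P)) * X $ c $ d)"
    by (subst sum_swap_pairs) (rule refl)
  also have "\<dots> = 1/2 * of_real s * (\<Sum>c\<in>UNIV. \<Sum>d\<in>UNIV.
      of_real (D (column a P) (column b P) (column c P) (column d P)) * X $ c $ d)"
    by (simp only: expand1[symmetric] of_real_sum sum_distrib_right)
  finally show ?thesis
    by (simp add: D_def det_vector_columns s_def sum_distrib_left mult_ac)
qed


text \<open>In the orthonormal basis given by the columns of \<open>P\<close> the volume element is
  the permutation symbol, so \<open>sd_matrixI\<close> applies; \<open>Q\<close> transports the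
  result back. Positive orientation matters: a negative \<open>det P\<close> would exchange
  self-dual and anti-self-dual.\<close>

lemma sd_bivector_normal_form:
  assumes "lorentzian g"
  obtains P Q :: "real^4^4" where "P ** Q = mat 1" "Q ** P = mat 1"
    "matrix_inv g = P ** minkowski ** transpose P" "g = transpose Q ** minkowski ** Q"
    "\<And>F. F \<in> sd_bivectors g \<Longrightarrow>
      \<exists>a b c. F = transpose (cmat Q) ** sd_matrix a b c ** cmat Q"
proof -
  obtain P where P: "det P > 0" "transpose P ** g ** P = minkowski"
    using lorentzian_oriented_frame[OF assms] by blast
  have "det P \<noteq> 0" using P(1) by simp
  then obtain Q where PQ: "P ** Q = mat 1" and QP: "Q ** P = mat 1"
    using invertible_det_nz[of P] by (auto simp: invertible_def)
  have PQt: "transpose P ** transpose Q = mat 1" "transpose Q ** transpose P = mat 1"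
    by (simp_all add: PQ QP flip: matrix_transpose_mul)
  have "transpose Q ** minkowski ** Q = (transpose Q ** transpose P) ** g ** (P ** Q)"
    by (simp only: P(2)[symmetric] matrix_mul_assoc)
  then have g: "g = transpose Q ** minkowski ** Q" by (simp add: PQ PQt)
  have "g ** (P ** minkowski ** transpose P)
      = transpose Q ** (minkowski ** (Q ** P) ** minkowski) ** transpose P"
    by (simp only: g matrix_mul_assoc)
  then have "g ** (P ** minkowski ** transpose P) = mat 1"
    by (simp add: QP PQt minkowski_square)
  then have inv: "matrix_inv g = P ** minkowski ** transpose P" by (rule matrix_inv_eqI)
  \<comment> \<open>Taking determinants in the congruence with the Minkowski matrix shows that the
    volume factor times \<open>det P\<close> is 1.\<close>
  have "det P ^ 2 * det g = - 1"
    using arg_cong[OF P(2), of det] by (simp add: det_mul det_minkowski power2_eq_square mult_ac)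
  then have "det P ^ 2 * \<bar>det g\<bar> = 1" by (metis abs_minus_cancel abs_mult abs_one abs_power2)
  then have "sqrt (det P ^ 2 * \<bar>det g\<bar>) = 1" by simp
  then have vol: "sqrt \<bar>det g\<bar> * det P = 1" using P(1) by (simp add: real_sqrt_mult mult.commute)
  have cPQ: "cmat P ** cmat Q = mat 1" "cmat Q ** cmat P = mat 1"
    "transpose (cmat P) ** transpose (cmat Q) = mat 1" "transpose (cmat Q) ** transpose (cmat P) = mat 1"
    by (simp_all add: PQ QP PQt cmat_mat flip: cmat_mult cmat_transpose)
  have "\<exists>a b c. F = transpose (cmat Q) ** sd_matrix a b c ** cmat Q" if F: "F \<in> sd_bivectors g" for F
  proof -
    define X where "X = transpose (cmat P) ** F ** cmat P"
    have skew: "transpose F = - F" and sd: "dual_bivector g F = cscale \<i> F"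
      using F by (auto simp: sd_bivectors_def)
    have raise: "raise_indices g F = cmat P ** (cminkowski ** X ** cminkowski) ** transpose (cmat P)"
      by (simp add: raise_indices_matrix inv cmat_mult cmat_transpose matrix_transpose_mul X_def
          flip: cmat_transpose)
        (simp add: transpose_minkowski matrix_mul_assoc)
    have "X = sd_matrix (X $ 1 $ 2) (X $ 1 $ 3) (X $ 1 $ 4)"
    proof (rule sd_matrixI)
      show "transpose X = - X"
        by (simp add: X_def matrix_transpose_mul skew matrix_mult_minus matrix_mul_assoc)
      fix a b
      have "(transpose (cmat P) ** dual_bivector g F ** cmat P) $ a $ b = \<i> * X $ a $ b"
        by (simp add: sd X_def cscale_matrix_mult)
      then show "1/2 * (\<Sum>c\<in>UNIV. \<Sum>d\<in>UNIV.
          of_real (permutation_symbol a b c d) * (cminkowski ** X ** cminkowski) $ c $ d) = \<i> * X $ a $ b"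
        unfolding dual_bivector_congruence[OF raise] vol by simp
    qed
    moreover have "F = transpose (cmat Q) ** X ** cmat Q"
    proof -
      have "transpose (cmat Q) ** X ** cmat Q
          = (transpose (cmat Q) ** transpose (cmat P)) ** F ** (cmat P ** cmat Q)"
        by (simp only: X_def matrix_mul_assoc)
      then show ?thesis by (simp add: cPQ)
    qed
    ultimately show ?thesis by metis
  qed
  then show thesis using that PQ QP inv g by blast
qed

text \<open>Congruence by \<open>Q\<close> reduces both identities to the entrywise ones for
  \<open>sd_matrix\<close> in an orthonormal basis.\<close>

lemma sd_bivector_products:
  assumes g: "lorentzian g" and F: "F \<in> sd_bivectors g" and H: "H \<in> sd_bivectors g"
  shows sd_bivector_anticommute:
      "tensor_dot g F H + tensor_dot g H F = cscale (- bivector_metric g F H) (cmat g)"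
    and sd_bivector_commute:
      "tensor_dot g F (conj_tensor H) = tensor_dot g (conj_tensor H) F"
proof -
  obtain P Q :: "real^4^4" where PQ: "P ** Q = mat 1" "Q ** P = mat 1"
    and inv: "matrix_inv g = P ** minkowski ** transpose P" and gQ: "g = transpose Q ** minkowski ** Q"
    and nf: "\<And>F. F \<in> sd_bivectors g \<Longrightarrow> \<exists>a b c. F = transpose (cmat Q) ** sd_matrix a b c ** cmat Q"
    using sd_bivector_normal_form[OF g] by blast
  have tPQ: "transpose P ** transpose Q = mat 1" by (simp add: PQ flip: matrix_transpose_mul)
  have cPQ: "cmat Q ** cmat P = mat 1" "transpose (cmat P) ** transpose (cmat Q) = mat 1"
    by (simp_all add: PQ tPQ cmat_mat flip: cmat_mult cmat_transpose)
  let ?J = "cmat P ** cminkowski ** transpose (cmat P)"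
  have J: "cmat (matrix_inv g) = ?J" by (simp add: inv cmat_mult cmat_transpose)
  have dot: "tensor_dot g (transpose (cmat Q) ** A ** cmat Q) (transpose (cmat Q) ** B ** cmat Q)
      = transpose (cmat Q) ** (A ** cminkowski ** B) ** cmat Q" for A B
  proof -
    have "tensor_dot g (transpose (cmat Q) ** A ** cmat Q) (transpose (cmat Q) ** B ** cmat Q)
        = transpose (cmat Q) ** A ** (cmat Q ** cmat P) ** cminkowski
          ** (transpose (cmat P) ** transpose (cmat Q)) ** B ** cmat Q"
      by (simp only: tensor_dot_matrix J matrix_mul_assoc)
    then show ?thesis by (simp add: cPQ matrix_mul_assoc)
  qed
  have conjQ: "conj_tensor (transpose (cmat Q) ** A ** cmat Q)
      = transpose (cmat Q) ** conj_tensor A ** cmat Q" for A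
    by (simp add: conj_tensor_mult flip: cmat_transpose)
  obtain a b c where F: "F = transpose (cmat Q) ** sd_matrix a b c ** cmat Q" using nf[OF F] by blast
  obtain a' b' c' where H': "H = transpose (cmat Q) ** sd_matrix a' b' c' ** cmat Q" using nf[OF H] by blast
  show "tensor_dot g F (conj_tensor H) = tensor_dot g (conj_tensor H) F"
    by (simp add: F H' conjQ dot sd_matrix_commute)
  have "tensor_dot g F H + tensor_dot g H F = transpose (cmat Q)
      ** (sd_matrix a b c ** cminkowski ** sd_matrix a' b' c' + sd_matrix a' b' c' ** cminkowski ** sd_matrix a b c)
      ** cmat Q"
    by (simp only: F H' dot matrix_add_ldistrib matrix_add_mult)
  also have "\<dots> = cscale (2 * (a * a' + b * b' + c * c')) (cmat g)"
    by (simp only: sd_matrix_anticommute cscale_matrix_mult gQ cmat_mult cmat_transpose)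
  also have "2 * (a * a' + b * b' + c * c') = - bivector_metric g F H"
  proof -
    let ?Z = "sd_matrix a b c ** cminkowski ** sd_matrix a' b' c' ** cminkowski"
    have "bivector_metric g F H = 1/2 * trace (F ** transpose (raise_indices g H))"
      by (simp add: bivector_metric_def trace_def matrix_matrix_mult_def transpose_def)
    \<comment> \<open>The bivector metric contracts both index pairs in the same order, a trace of a
      product contracts them crosswise; skewness of \<open>H\<close> turns this into a sign.\<close>
    also have "F ** transpose (raise_indices g H) = - (tensor_dot g F H ** ?J)"
    proof -
      have "transpose H = - H" using H by (simp add: sd_bivectors_def)
      then show ?thesis
        by (simp add: raise_indices_matrix J matrix_transpose_mul matrix_mult_minus tensor_dot_matrix
            matrix_mul_assoc transpose_minkowski flip: cmat_transpose)
    qed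
    also have "tensor_dot g F H ** ?J = transpose (cmat Q) ** (?Z ** transpose (cmat P))"
    proof -
      have "tensor_dot g F H ** ?J = transpose (cmat Q) ** (sd_matrix a b c ** cminkowski
          ** sd_matrix a' b' c' ** (cmat Q ** cmat P) ** cminkowski ** transpose (cmat P))"
        by (simp only: F H' dot matrix_mul_assoc)
      then show ?thesis by (simp add: cPQ)
    qed
    also have "trace (- \<dots>) = - trace (?Z ** (transpose (cmat P) ** transpose (cmat Q)))"
      unfolding trace_minus trace_mul_sym[of "transpose (cmat Q)" "?Z ** transpose (cmat P)"]
      by (simp only: matrix_mul_assoc)
    finally have "bivector_metric g F H = 1/2 * - (4 * (a * a' + b * b' + c * c'))"
      by (simp only: cPQ matrix_mul_rid sd_matrix_metric)
    then show ?thesis by (simp only:) (simp add: field_simps)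
  qed
  finally show "tensor_dot g F H + tensor_dot g H F = cscale (- bivector_metric g F H) (cmat g)" .
qed


text \<open>Symmetry of the metric and of its inverse is inherited from the Minkowski matrix through
  the congruence.\<close>

lemma lorentzian_inverse:
  assumes "lorentzian g"
  shows "transpose (cmat (matrix_inv g)) = cmat (matrix_inv g)"
    "cmat (matrix_inv g) ** cmat g = mat 1" "cmat g ** cmat (matrix_inv g) = mat 1"
    "transpose (cmat g) = cmat g"
proof -
  obtain P Q :: "real^4^4" where PQ: "P ** Q = mat 1" "Q ** P = mat 1"
    and inv: "matrix_inv g = P ** minkowski ** transpose P" and gQ: "g = transpose Q ** minkowski ** Q"
    using sd_bivector_normal_form[OF assms] by blast
  have tPQ: "transpose P ** transpose Q = mat 1" by (simp add: PQ flip: matrix_transpose_mul)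
  have "matrix_inv g ** g = P ** minkowski ** (transpose P ** transpose Q) ** minkowski ** Q"
    by (subst inv, subst gQ) (simp only: matrix_mul_assoc)
  also have "\<dots> = P ** (minkowski ** minkowski) ** Q" by (simp add: tPQ matrix_mul_assoc)
  finally have 1: "matrix_inv g ** g = mat 1" by (simp add: minkowski_square PQ)
  then have "g ** matrix_inv g = mat 1" using matrix_left_right_inverse by blast
  with 1 show "cmat (matrix_inv g) ** cmat g = mat 1" "cmat g ** cmat (matrix_inv g) = mat 1"
    by (simp_all add: cmat_mat flip: cmat_mult)
  show "transpose (cmat (matrix_inv g)) = cmat (matrix_inv g)"
    unfolding inv cmat_transpose[symmetric]
    by (simp add: matrix_transpose_mul transpose_minkowski matrix_mul_assoc)
  show "transpose (cmat g) = cmat g"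
    unfolding cmat_transpose[symmetric]
    by (subst (1 2) gQ) (simp add: matrix_transpose_mul transpose_minkowski matrix_mul_assoc)
qed

section \<open>Expansion of tensors in a self-dual frame\<close>

lemma conj_tensor_add: "conj_tensor (A + B) = conj_tensor A + conj_tensor B"
  by (simp add: vec_eq_iff)

lemma transpose_conj_tensor: "transpose (conj_tensor A) = conj_tensor (transpose A)"
  by (simp add: vec_eq_iff transpose_def)

lemma conj_tensor_minus: "conj_tensor (- A) = - conj_tensor A"
  by (simp add: vec_eq_iff)

lemma conj_tensor_if_mat:
  "conj_tensor (if b then mat 1 else 0) = (if b then mat 1 else 0)"
  by (simp add: vec_eq_iff mat_def)

lemma sum_option: "(\<Sum>a\<in>UNIV. f a) = f None + (\<Sum>i\<in>UNIV. f (Some i))"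
  for f :: "'i::finite option \<Rightarrow> 'b::comm_monoid_add"
  by (simp add: UNIV_option_conv sum.reindex)

lemma sum_bool_prod: "(\<Sum>p\<in>UNIV. f p) = (\<Sum>i\<in>UNIV. f (True, i)) + (\<Sum>i\<in>UNIV. f (False, i))"
  for f :: "bool \<times> 'i::finite \<Rightarrow> 'b::comm_monoid_add"
proof -
  have "(\<Sum>p\<in>UNIV \<times> UNIV. f p) = (\<Sum>b\<in>UNIV. \<Sum>i\<in>UNIV. f (b, i))"
    by (rule sum.cartesian_product')
  then show ?thesis by (simp only: UNIV_Times_UNIV) (simp add: UNIV_bool add.commute)
qed

text \<open>The metric and the volume element are real. Hence conjugates of self-dual bivectors are
  anti-self-dual.\<close>

lemma dual_bivector_conj: "dual_bivector g (conj_tensor F) = conj_tensor (dual_bivector g F)"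
  by (simp add: vec_eq_iff dual_bivector_def raise_indices_def)

lemma dual_bivector_linear:
  "dual_bivector g (A + B) = dual_bivector g A + dual_bivector g B"
  "dual_bivector g (cscale c A) = cscale c (dual_bivector g A)"
proof -
  have "raise_indices g (A + B) = raise_indices g A + raise_indices g B"
    by (simp add: raise_indices_matrix matrix_add_ldistrib matrix_add_mult)
  then show "dual_bivector g (A + B) = dual_bivector g A + dual_bivector g B"
    by (simp add: vec_eq_iff dual_bivector_def distrib_left sum.distrib)
  have "raise_indices g (cscale c A) = cscale c (raise_indices g A)"
    by (simp add: raise_indices_matrix cscale_matrix_mult)
  then show "dual_bivector g (cscale c A) = cscale c (dual_bivector g A)"
    by (simp add: vec_eq_iff dual_bivector_def sum_distrib_left mult_ac)
qed

lemma dual_bivector_sum: "dual_bivector g (\<Sum>i\<in>I. A i) = (\<Sum>i\<in>I. dual_bivector g (A i))"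
proof -
  have "dual_bivector g 0 = 0" by (simp add: vec_eq_iff dual_bivector_def raise_indices_def)
  then show ?thesis
    by (induction I rule: infinite_finite_induct) (simp_all add: dual_bivector_linear)
qed

locale sd_frame =
  fixes g :: "real^4^4" and U :: "3 \<Rightarrow> complex^4^4"
  assumes lorentzian: "lorentzian g" and frame: "orthonormal_sd_frame g U"
begin

abbreviation J :: "complex^4^4" where
  "J \<equiv> cmat (matrix_inv g)"

abbreviation frame_prod :: "3 \<Rightarrow> 3 \<Rightarrow> complex^4^4" where
  "frame_prod j k \<equiv> tensor_dot g (U j) (conj_tensor (U k))"

lemmas J_simps = lorentzian_inverse[OF lorentzian]

lemma U_sd: "U i \<in> sd_bivectors g"
  using frame ctensor.span_base by (auto simp: orthonormal_sd_frame_def)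

lemma U_skew: "transpose (U i) = - U i"
  and U_dual: "dual_bivector g (U i) = cscale \<i> (U i)"
  using U_sd[of i] by (simp_all add: sd_bivectors_def)

lemma U_anticommute:
  "U i ** J ** U j + U j ** J ** U i = cscale (if i = j then 1 else 0) (cmat g)"
  using sd_bivector_anticommute[OF lorentzian U_sd U_sd, of i j] frame
  by (simp add: tensor_dot_matrix orthonormal_sd_frame_def)

lemma mixed_anticommute:
  "U i ** J ** (U j ** J) + U j ** J ** (U i ** J) = (if i = j then mat 1 else 0)"
proof -
  have "U i ** J ** (U j ** J) + U j ** J ** (U i ** J) = (U i ** J ** U j + U j ** J ** U i) ** J"
    by (simp add: matrix_add_mult matrix_mul_assoc)
  then show ?thesis
    by (simp add: U_anticommute cscale_matrix_mult J_simps vec_eq_iff)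
qed

definition u :: "3 \<Rightarrow> complex^4^4" where "u i = U i ** J"

definition v :: "3 \<Rightarrow> complex^4^4" where "v i = conj_tensor (U i) ** J"

sublocale clifford_pair u v
proof
  fix i j
  show u: "u i ** u j + u j ** u i = (if i = j then mat 1 else 0)"
    unfolding u_def by (rule mixed_anticommute)
  \<comment> \<open>The inverse metric is real, so the relations for \<open>v\<close> are the
    conjugates of those for \<open>u\<close>.\<close>
  have v: "v i = conj_tensor (u i)" for i
    by (simp add: u_def v_def conj_tensor_mult)
  show "v i ** v j + v j ** v i = (if i = j then mat 1 else 0)"
    using arg_cong[OF u, of conj_tensor] unfolding conj_tensor_if_mat
    by (simp only: v conj_tensor_add conj_tensor_mult)
  show "u i ** v j = v j ** u i"
    using sd_bivector_commute[OF lorentzian U_sd U_sd, of i j]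
    by (simp add: tensor_dot_matrix matrix_mul_assoc u_def v_def)
qed

text \<open>The full contraction with crossed indices, that is, the trace form of the mixed tensors.
  On bivectors it equals -2 times the bivector metric, so frame members have norm 2 rather than
  -1.\<close>

definition pairing :: "complex^4^4 \<Rightarrow> complex^4^4 \<Rightarrow> complex" where
  "pairing A B = trace (A ** J ** (B ** J))"

lemma pairing_sym: "pairing A B = pairing B A"
  unfolding pairing_def by (rule trace_mul_sym)

lemma pairing_linear:
  "pairing (A + A') B = pairing A B + pairing A' B" "pairing (cscale c A) B = c * pairing A B"
  by (simp_all add: pairing_def matrix_add_mult trace_add cscale_matrix_mult trace_cscale)

lemma pairing_sum: "pairing (\<Sum>i\<in>I. A i) B = (\<Sum>i\<in>I. pairing (A i) B)"
  by (simp add: pairing_def matrix_mult_sum_left trace_sum)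

lemma pairing_transpose: "pairing (transpose A) (transpose B) = pairing A B"
proof -
  have "pairing (transpose A) (transpose B) = trace (transpose (J ** (B ** (J ** A))))"
    by (simp add: pairing_def matrix_transpose_mul J_simps matrix_mul_assoc)
  also have "\<dots> = trace (J ** B ** (J ** A))" by (simp add: trace_transpose matrix_mul_assoc)
  also have "\<dots> = trace (A ** (J ** B ** J))"
    using trace_mul_sym[of "J ** B ** J" A] by (simp add: matrix_mul_assoc)
  finally show ?thesis by (simp add: pairing_def matrix_mul_assoc)
qed

lemma pairing_minus: "pairing (- A) B = - pairing A B" "pairing A (- B) = - pairing A B"
  by (simp_all add: pairing_def matrix_mult_minus trace_minus)

lemma pairing_sym_skew:
  assumes "transpose A = A" "transpose B = - B"
  shows "pairing A B = 0"
  using pairing_transpose[of A B] assms by (simp add: pairing_minus)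

lemma pairing_components: "pairing A B = (\<Sum>i\<in>UNIV. \<Sum>j\<in>UNIV. A $ i $ j * (J ** B ** J) $ j $ i)"
proof -
  have "pairing A B = trace (A ** (J ** B ** J))" by (simp add: pairing_def matrix_mul_assoc)
  then show ?thesis by (simp only: trace_def matrix_matrix_mult_def vec_lambda_beta)
qed

lemma contract_components:
  "contract g X A $ a $ b = (\<Sum>m\<in>UNIV. \<Sum>n\<in>UNIV. X $ a $ b $ m $ n * (J ** A ** J) $ m $ n)"
  by (simp add: contract_def raise_indices_matrix J_simps)

text \<open>\<open>contract\<close> matches indices in order and \<open>pairing\<close> crosswise,
  whence the transpose.\<close>

lemma contract_tensor_prod: "contract g (tensor_prod X Y) A = cscale (pairing (transpose Y) A) X"
  unfolding vec_eq_iff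
proof (intro allI)
  fix a b
  have "pairing (transpose Y) A = (\<Sum>m\<in>UNIV. \<Sum>n\<in>UNIV. Y $ n $ m * (J ** A ** J) $ n $ m)"
    by (simp add: pairing_components transpose_def)
  also have "\<dots> = (\<Sum>m\<in>UNIV. \<Sum>n\<in>UNIV. Y $ m $ n * (J ** A ** J) $ m $ n)" by (rule sum.swap)
  finally show "contract g (tensor_prod X Y) A $ a $ b = cscale (pairing (transpose Y) A) X $ a $ b"
    by (simp add: contract_components tensor_prod_def sum_distrib_left mult_ac)
qed

lemma conj_U_skew: "transpose (conj_tensor (U i)) = - conj_tensor (U i)"
  by (simp add: transpose_conj_tensor U_skew conj_tensor_minus)

lemma frame_prod_commute: "frame_prod j k = conj_tensor (U k) ** J ** U j"
  using sd_bivector_commute[OF lorentzian U_sd U_sd, of j k] by (simp add: tensor_dot_matrix)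

text \<open>Transposition reverses the factors, the two signs from skewness cancel, and the
  commutation relation restores the order.\<close>

lemma frame_prod_sym: "transpose (frame_prod j k) = frame_prod j k"
proof -
  have "transpose (frame_prod j k) = conj_tensor (U k) ** J ** U j"
    by (simp add: tensor_dot_matrix matrix_transpose_mul J_simps U_skew conj_U_skew matrix_mult_minus
        matrix_mul_assoc)
  then show ?thesis by (simp add: frame_prod_commute)
qed

lemma E_lowered: "E (None, None) ** cmat g = cmat g" "E (Some i, None) ** cmat g = U i"
  "E (None, Some i) ** cmat g = conj_tensor (U i)" "E (Some i, Some j) ** cmat g = frame_prod i j"
  by (simp_all add: E_def u_def v_def tensor_dot_matrix J_simps flip: matrix_mul_assoc)

lemma E_mixed: "E (None, None) = cmat g ** J" "E (Some i, None) = U i ** J"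
  "E (None, Some i) = conj_tensor (U i) ** J" "E (Some i, Some j) = frame_prod i j ** J"
  by (simp_all add: E_def u_def v_def tensor_dot_matrix J_simps matrix_mul_assoc)

lemma pairing_frame [simp]:
  "pairing (U i) (U j) = (if i = j then 2 else 0)"
  "pairing (conj_tensor (U i)) (conj_tensor (U j)) = (if i = j then 2 else 0)"
  "pairing (U i) (conj_tensor (U j)) = 0" "pairing (conj_tensor (U i)) (U j) = 0"
  "pairing (frame_prod i j) (frame_prod k l) = (if i = k \<and> j = l then 1 else 0)"
  "pairing (frame_prod i j) (cmat g) = 0"
  by (simp_all add: pairing_def trace_E_mult weight_def flip: E_mixed)

text \<open>The trace expansion of the mixed tensor \<open>A ** J\<close>, lowered again with the
  metric. The denominators 4, 2, 2, 1 are the values of \<open>weight\<close>.\<close>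

lemma pairing_expansion:
  "A = cscale (pairing A (cmat g) / 4) (cmat g) + (\<Sum>i\<in>UNIV. cscale (pairing A (U i) / 2) (U i))
    + (\<Sum>i\<in>UNIV. cscale (pairing A (conj_tensor (U i)) / 2) (conj_tensor (U i)))
    + (\<Sum>i\<in>UNIV. \<Sum>j\<in>UNIV. cscale (pairing A (frame_prod i j)) (frame_prod i j))"
proof -
  have "A = A ** J ** cmat g" by (simp add: J_simps flip: matrix_mul_assoc)
  also have "A ** J = (\<Sum>p\<in>UNIV. cscale (trace (A ** J ** E p) / weight p) (E p))"
    by (rule expansion)
  also have "\<dots> ** cmat g = (\<Sum>p\<in>UNIV \<times> UNIV. cscale (trace (A ** J ** E p) / weight p) (E p ** cmat g))"
    by (simp add: matrix_mult_sum_left cscale_matrix_mult)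
  also have "\<dots> = (\<Sum>a\<in>UNIV. \<Sum>b\<in>UNIV.
      cscale (trace (A ** J ** E (a, b)) / weight (a, b)) (E (a, b) ** cmat g))"
    by (rule sum.cartesian_product')
  finally show ?thesis
    by (simp add: sum_option E_lowered weight_def sum.distrib)
      (simp add: pairing_def E_mixed add_ac)
qed

lemma skew_expansion:
  assumes "transpose A = - A"
  shows "A = (\<Sum>i\<in>UNIV. cscale (pairing A (U i) / 2) (U i))
    + (\<Sum>i\<in>UNIV. cscale (pairing A (conj_tensor (U i)) / 2) (conj_tensor (U i)))"
proof -
  have "pairing A (cmat g) = 0" "pairing A (frame_prod i j) = 0" for i j
    using pairing_sym_skew[of _ A] assms by (simp_all add: pairing_sym[of A] J_simps frame_prod_sym)
  then show ?thesis using pairing_expansion[of A] by simp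
qed

lemma symmetric_trace:
  assumes "transpose A = A"
  shows "(\<Sum>a\<in>UNIV. \<Sum>b\<in>UNIV. of_real (matrix_inv g $ a $ b) * A $ a $ b) = pairing A (cmat g)"
proof -
  have "transpose A $ b $ a = A $ a $ b" for a b by (simp add: transpose_def)
  then have "A $ a $ b = A $ b $ a" for a b unfolding assms by simp
  then have "(\<Sum>a\<in>UNIV. \<Sum>b\<in>UNIV. of_real (matrix_inv g $ a $ b) * A $ a $ b)
      = (\<Sum>a\<in>UNIV. \<Sum>b\<in>UNIV. J $ a $ b * A $ b $ a)"
    by (intro sum.cong) auto
  also have "\<dots> = trace (J ** A)"
    by (simp only: trace_def matrix_matrix_mult_def vec_lambda_beta)
  also have "\<dots> = pairing A (cmat g)"
    by (simp add: pairing_def J_simps trace_mul_sym[of A])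
  finally show ?thesis .
qed

text \<open>Pairings with bivectors vanish by symmetry and the pairing with the metric is the trace,
  so only the nine frame products survive.\<close>

lemma traceless_symmetric_expansion:
  assumes "A \<in> traceless_symmetric g"
  shows "A = (\<Sum>i\<in>UNIV. \<Sum>j\<in>UNIV. cscale (pairing A (frame_prod i j)) (frame_prod i j))"
proof -
  have sym: "transpose A = A" using assms by (simp add: traceless_symmetric_def)
  have "pairing A (cmat g) = 0"
    using assms symmetric_trace[OF sym] by (simp add: traceless_symmetric_def)
  moreover have "pairing A (U i) = 0" "pairing A (conj_tensor (U i)) = 0" for i
    by (simp_all add: pairing_sym_skew sym U_skew conj_U_skew)
  ultimately show ?thesis using pairing_expansion[of A] by simp
qed

lemma frame_prod_traceless_symmetric: "frame_prod j k \<in> traceless_symmetric g"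
  using symmetric_trace[OF frame_prod_sym] by (simp add: traceless_symmetric_def frame_prod_sym)

section \<open>The self-dual Weyl tensor\<close>

lemma conj_U_dual: "dual_bivector g (conj_tensor (U i)) = cscale (- \<i>) (conj_tensor (U i))"
  by (simp add: dual_bivector_conj U_dual) (simp add: vec_eq_iff)

text \<open>The Boolean tag merges frame and conjugate frame into one family of six, so that a
  curvature-like tensor has a single coefficient matrix.\<close>

definition bivector :: "bool \<times> 3 \<Rightarrow> complex^4^4" where
  "bivector a = (if fst a then U (snd a) else conj_tensor (U (snd a)))"

lemma bivector_simps [simp]:
  "bivector (True, i) = U i" "bivector (False, i) = conj_tensor (U i)"
  by (simp_all add: bivector_def)

lemma bivector_skew: "transpose (bivector a) = - bivector a"
  by (simp add: bivector_def U_skew conj_U_skew)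

lemma bivector_expansion:
  assumes "transpose A = - A"
  shows "A = (\<Sum>a\<in>UNIV. cscale (pairing A (bivector a) / 2) (bivector a))"
  using skew_expansion[OF assms] by (simp only: sum_bool_prod bivector_simps)

lemma bivector_expansion_nth:
  assumes "\<And>i j. f i j = - f j i"
  shows "f i j = (\<Sum>a\<in>UNIV. pairing (\<chi> k l. f k l) (bivector a) / 2 * bivector a $ i $ j)"
proof -
  have "transpose (\<chi> k l. f k l) = - (\<chi> k l. f k l)"
  proof (intro iffD2[OF vec_eq_iff] allI)
    fix i j
    show "transpose (\<chi> k l. f k l) $ i $ j = (- (\<chi> k l. f k l)) $ i $ j"
      using assms[of j i] by (simp add: transpose_def)
  qed
  from arg_cong[OF bivector_expansion[OF this], of "\<lambda>A. A $ i $ j"]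
  show ?thesis by simp
qed

text \<open>The first index pair is expanded with the last two indices frozen. The coefficients are
  skew in those, so they expand in turn. Each expansion divides by the norm 2, and pair symmetry
  makes the coefficient matrix symmetric.\<close>

lemma curvature_expansion:
  fixes R :: "4 \<Rightarrow> 4 \<Rightarrow> 4 \<Rightarrow> 4 \<Rightarrow> complex"
  assumes skew1: "\<And>i j k l. R i j k l = - R j i k l"
    and skew2: "\<And>i j k l. R i j k l = - R i j l k"
    and swap: "\<And>i j k l. R i j k l = R k l i j"
  obtains w where "\<And>a c. w a c = w c a"
    "\<And>i j k l. R i j k l = (\<Sum>a\<in>UNIV. \<Sum>c\<in>UNIV. w a c * bivector a $ i $ j * bivector c $ k $ l)"
proof -
  define p where "p a k l = pairing (\<chi> i j. R i j k l) (bivector a)" for a k l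
  define w where "w a c = pairing (\<chi> k l. p a k l) (bivector c) / 4" for a c
  have p: "p a k l = (\<Sum>i\<in>UNIV. \<Sum>j\<in>UNIV. R i j k l * (J ** bivector a ** J) $ j $ i)" for a k l
    by (simp add: p_def pairing_components)
  have "p a k l = - p a l k" for a k l
    unfolding p by (subst skew2) (simp add: sum_negf)
  note p_expand = bivector_expansion_nth[of "p _", OF this]
  have "R i j k l = (\<Sum>a\<in>UNIV. \<Sum>c\<in>UNIV. w a c * bivector a $ i $ j * bivector c $ k $ l)" for i j k l
  proof -
    have "R i j k l = (\<Sum>a\<in>UNIV. p a k l / 2 * bivector a $ i $ j)"
      using bivector_expansion_nth[of "\<lambda>i j. R i j k l" i j, OF skew1] by (simp only: p_def)
    also have "\<dots> = (\<Sum>a\<in>UNIV. (\<Sum>c\<in>UNIV. 2 * w a c * bivector c $ k $ l) / 2 * bivector a $ i $ j)"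
      by (subst p_expand) (simp add: w_def)
    finally show ?thesis by (simp add: sum_divide_distrib sum_distrib_left sum_distrib_right mult_ac)
  qed
  moreover have "w a c = w c a" for a c
  proof -
    define X where "X a i j = (J ** bivector a ** J) $ j $ i" for a i j
    have w: "4 * w a c = (\<Sum>k\<in>UNIV. \<Sum>l\<in>UNIV. \<Sum>i\<in>UNIV. \<Sum>j\<in>UNIV. R i j k l * X a i j * X c k l)" for a c
      by (simp add: w_def pairing_components p X_def sum_distrib_right)
    have "4 * w a c = (\<Sum>i\<in>UNIV. \<Sum>j\<in>UNIV. \<Sum>k\<in>UNIV. \<Sum>l\<in>UNIV. R i j k l * X a i j * X c k l)"
      unfolding w by (rule sum_swap_pairs)
    also have "\<dots> = (\<Sum>i\<in>UNIV. \<Sum>j\<in>UNIV. \<Sum>k\<in>UNIV. \<Sum>l\<in>UNIV. R k l i j * X c k l * X a i j)"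
      by (subst swap) (simp add: mult_ac)
    also have "\<dots> = 4 * w c a" unfolding w ..
    finally show ?thesis by simp
  qed
  ultimately show thesis using that by blast
qed

lemma mixed_bivector: "bivector (True, i) ** J = u i" "bivector (False, i) ** J = v i"
  by (simp_all add: u_def v_def)

text \<open>Skewness of \<open>A\<close> brings the contracted index next to \<open>B\<close>, at
  the cost of a sign.\<close>

lemma contracted_product:
  assumes "transpose A = - A"
  shows "(\<Sum>i\<in>UNIV. \<Sum>k\<in>UNIV. J $ i $ k * (A $ i $ j * B $ k $ l)) = - (A ** J ** B) $ j $ l"
proof -
  have A: "A $ i $ j = - A $ j $ i" for i
    using assms by (metis (no_types, lifting) transpose_def vec_lambda_beta vector_uminus_component)
  have "(A ** J ** B) $ j $ l = (\<Sum>k\<in>UNIV. \<Sum>i\<in>UNIV. A $ j $ i * J $ i $ k * B $ k $ l)"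
    by (simp add: matrix_matrix_mult_def sum_distrib_right)
  also have "\<dots> = (\<Sum>i\<in>UNIV. \<Sum>k\<in>UNIV. A $ j $ i * J $ i $ k * B $ k $ l)" by (rule sum.swap)
  finally show ?thesis by (subst A) (simp add: sum_negf mult_ac)
qed

text \<open>
  The coefficients of the mixed products of a frame bivector and a conjugate one are read off the
  Ricci trace, since their contractions are the linearly independent traceless symmetric tensors.
\<close>

lemma weyl_decomposition:
  assumes W: "weyl_tensor g W"
  obtains c d where
    "\<And>\<alpha> \<beta> \<mu> \<nu>. complex_of_real (W $ \<alpha> $ \<beta> $ \<mu> $ \<nu>) =
      (\<Sum>i\<in>UNIV. \<Sum>j\<in>UNIV. c i j * U i $ \<alpha> $ \<beta> * U j $ \<mu> $ \<nu>)
      + (\<Sum>i\<in>UNIV. \<Sum>j\<in>UNIV. d i j * conj_tensor (U i) $ \<alpha> $ \<beta> * conj_tensor (U j) $ \<mu> $ \<nu>)"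
    "(\<Sum>i\<in>UNIV. c i i) + (\<Sum>i\<in>UNIV. d i i) = 0"
proof -
  define R where "R \<alpha> \<beta> \<mu> \<nu> = complex_of_real (W $ \<alpha> $ \<beta> $ \<mu> $ \<nu>)" for \<alpha> \<beta> \<mu> \<nu>
  have W_sym: "W $ i $ j $ k $ l = - W $ j $ i $ k $ l" "W $ i $ j $ k $ l = - W $ i $ j $ l $ k"
    "W $ i $ j $ k $ l = W $ k $ l $ i $ j" for i j k l
    using W unfolding weyl_tensor_def by blast+
  have "R i j k l = - R j i k l" "R i j k l = - R i j l k" "R i j k l = R k l i j" for i j k l
    using arg_cong[OF W_sym(1)[of i j k l], of complex_of_real]
      arg_cong[OF W_sym(2)[of i j k l], of complex_of_real]
      arg_cong[OF W_sym(3)[of i j k l], of complex_of_real]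
    by (simp_all only: R_def of_real_minus)
  from curvature_expansion[of R, OF this] obtain w where w_sym: "\<And>a c. w a c = w c a"
    and R: "\<And>i j k l. R i j k l = (\<Sum>a\<in>UNIV. \<Sum>c\<in>UNIV. w a c * bivector a $ i $ j * bivector c $ k $ l)"
    by blast
  have "(\<Sum>a\<in>UNIV. \<Sum>c\<in>UNIV. cscale (w a c) (bivector a ** J ** bivector c)) $ \<beta> $ \<nu> = 0 $ \<beta> $ \<nu>" for \<beta> \<nu>
  proof -
    have "(\<Sum>\<alpha>\<in>UNIV. \<Sum>\<mu>\<in>UNIV. matrix_inv g $ \<alpha> $ \<mu> * W $ \<alpha> $ \<beta> $ \<mu> $ \<nu>) = 0"
      using W unfolding weyl_tensor_def by blast
    then have "0 = complex_of_real (\<Sum>\<alpha>\<in>UNIV. \<Sum>\<mu>\<in>UNIV. matrix_inv g $ \<alpha> $ \<mu> * W $ \<alpha> $ \<beta> $ \<mu> $ \<nu>)"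
      by simp
    also have "\<dots> = (\<Sum>\<alpha>\<in>UNIV. \<Sum>\<mu>\<in>UNIV. J $ \<alpha> $ \<mu> * R \<alpha> \<beta> \<mu> \<nu>)" by (simp add: R_def)
    also have "\<dots> = (\<Sum>\<alpha>\<in>UNIV. \<Sum>\<mu>\<in>UNIV. \<Sum>a\<in>UNIV. \<Sum>c\<in>UNIV.
        w a c * (J $ \<alpha> $ \<mu> * (bivector a $ \<alpha> $ \<beta> * bivector c $ \<mu> $ \<nu>)))"
      unfolding R by (simp add: sum_distrib_left mult_ac)
    also have "\<dots> = (\<Sum>a\<in>UNIV. \<Sum>c\<in>UNIV. \<Sum>\<alpha>\<in>UNIV. \<Sum>\<mu>\<in>UNIV.
        w a c * (J $ \<alpha> $ \<mu> * (bivector a $ \<alpha> $ \<beta> * bivector c $ \<mu> $ \<nu>)))"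
      by (rule sum_swap_pairs)
    also have "\<dots> = (\<Sum>a\<in>UNIV. \<Sum>c\<in>UNIV. w a c * - (bivector a ** J ** bivector c) $ \<beta> $ \<nu>)"
      by (simp only: contracted_product[OF bivector_skew] flip: sum_distrib_left)
    finally show ?thesis by (simp add: sum_negf)
  qed
  then have "(\<Sum>a\<in>UNIV. \<Sum>c\<in>UNIV. cscale (w a c) (bivector a ** J ** bivector c)) = 0"
    by (intro iffD2[OF vec_eq_iff] allI)
  then have "(\<Sum>a\<in>UNIV. \<Sum>c\<in>UNIV. cscale (w a c) (bivector a ** J ** bivector c)) ** J = 0"
    by (simp only: matrix_zero_mult)
  then have ricci: "(\<Sum>a\<in>UNIV. \<Sum>c\<in>UNIV. cscale (w a c) (bivector a ** J ** (bivector c ** J))) = 0"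
    by (simp add: matrix_mult_sum_left cscale_matrix_mult matrix_mul_assoc)
  \<comment> \<open>Tracing the Ricci condition against \<open>u j ** v k\<close> kills the unmixed
    products. The two orders of the mixed product contribute equally because \<open>w\<close> is
    symmetric.\<close>
  have mixed: "w (True, j) (False, k) = 0" for j k
  proof -
    have "(\<Sum>a\<in>UNIV. \<Sum>c\<in>UNIV. w a c * trace (bivector a ** J ** (bivector c ** J) ** (u j ** v k))) = 0"
      using arg_cong[OF ricci, of "\<lambda>X. trace (X ** (u j ** v k))"]
      by (simp add: matrix_mult_sum_left cscale_matrix_mult trace_sum trace_cscale trace_zero matrix_zero_mult)
    then have "(\<Sum>l\<in>UNIV. \<Sum>m\<in>UNIV. w (True, l) (False, m) * (if l = j \<and> m = k then 1 else 0))
      + (\<Sum>m\<in>UNIV. \<Sum>l\<in>UNIV. w (False, m) (True, l) * (if l = j \<and> m = k then 1 else 0)) = 0"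
      by (simp only: sum_bool_prod mixed_bivector trace_uuuv trace_vvuv trace_uvuv
          uv_commute[symmetric] sum.distrib) (simp add: add.commute)
    moreover have "(\<Sum>l\<in>UNIV. \<Sum>m\<in>UNIV. w (True, l) (False, m) * (if l = j \<and> m = k then 1 else 0))
        = (\<Sum>l\<in>UNIV. if l = j then w (True, j) (False, k) else 0)"
      by (rule sum.cong) (auto simp: if_distrib[where f = "(*) _"] cong: if_cong)
    moreover have "(\<Sum>m\<in>UNIV. \<Sum>l\<in>UNIV. w (False, m) (True, l) * (if l = j \<and> m = k then 1 else 0))
        = (\<Sum>m\<in>UNIV. if m = k then w (False, k) (True, j) else 0)"
      by (rule sum.cong) (auto simp: if_distrib[where f = "(*) _"] cong: if_cong)
    ultimately show ?thesis using w_sym[of "(False, k)"] by simp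
  qed
  define c where "c i j = w (True, i) (True, j)" for i j
  define d where "d i j = w (False, i) (False, j)" for i j
  have expansion: "R \<alpha> \<beta> \<mu> \<nu> = (\<Sum>i\<in>UNIV. \<Sum>j\<in>UNIV. c i j * U i $ \<alpha> $ \<beta> * U j $ \<mu> $ \<nu>)
      + (\<Sum>i\<in>UNIV. \<Sum>j\<in>UNIV. d i j * conj_tensor (U i) $ \<alpha> $ \<beta> * conj_tensor (U j) $ \<mu> $ \<nu>)" for \<alpha> \<beta> \<mu> \<nu>
    unfolding R sum_bool_prod bivector_simps
    by (simp add: sum.distrib c_def d_def mixed w_sym[of "(False, _)" "(True, _)"])
  \<comment> \<open>The trace of the Ricci condition, that is, vanishing scalar curvature.\<close>
  have "(\<Sum>i\<in>UNIV. c i i) + (\<Sum>i\<in>UNIV. d i i) = 0"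
  proof -
    have "(\<Sum>a\<in>UNIV. \<Sum>c\<in>UNIV. w a c * trace (bivector a ** J ** (bivector c ** J))) = 0"
      using arg_cong[OF ricci, of trace] by (simp add: trace_sum trace_cscale trace_zero)
    then have "(\<Sum>i\<in>UNIV. \<Sum>j\<in>UNIV. c i j * (if i = j then 2 else 0))
      + (\<Sum>i\<in>UNIV. \<Sum>j\<in>UNIV. d i j * (if i = j then 2 else 0)) = 0"
      by (simp only: sum_bool_prod mixed_bivector trace_uu trace_vv trace_uv c_def d_def
          uv_commute[symmetric] sum.distrib) simp
    then have "(\<Sum>i\<in>UNIV. c i i) * 2 + (\<Sum>i\<in>UNIV. d i i) * 2 = 0"
      by (simp add: if_distrib[where f = "(*) _"] cong: if_cong flip: sum_distrib_right)
    then show ?thesis by algebra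
  qed
  then show thesis by (rule that[OF expansion[unfolded R_def]])
qed

section \<open>Consequences of the cyclic identity\<close>

text \<open>These are the three cyclic terms of a product of bivectors, contracted with a third
  bivector over the first two indices of the cyclic identity. The signs come from skewness of the
  factors and of the raised \<open>Y\<close>.\<close>

lemma bianchi_products:
  fixes A B Y :: "complex^4^4"
  assumes A: "transpose A = - A" and B: "transpose B = - B" and Y: "transpose Y = - Y"
  shows "(\<Sum>\<alpha>\<in>UNIV. \<Sum>\<beta>\<in>UNIV. (J ** Y ** J) $ \<alpha> $ \<beta> * (A $ \<alpha> $ \<beta> * B $ \<mu> $ \<nu>)) = - pairing A Y * B $ \<mu> $ \<nu>"
    "(\<Sum>\<alpha>\<in>UNIV. \<Sum>\<beta>\<in>UNIV. (J ** Y ** J) $ \<alpha> $ \<beta> * (A $ \<alpha> $ \<mu> * B $ \<nu> $ \<beta>)) = (A ** J ** Y ** J ** B) $ \<mu> $ \<nu>"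
    "(\<Sum>\<alpha>\<in>UNIV. \<Sum>\<beta>\<in>UNIV. (J ** Y ** J) $ \<alpha> $ \<beta> * (A $ \<alpha> $ \<nu> * B $ \<beta> $ \<mu>)) = (B ** J ** Y ** J ** A) $ \<mu> $ \<nu>"
proof -
  define Z where "Z = J ** Y ** J"
  have Z: "transpose Z = - Z"
    by (simp add: Z_def matrix_transpose_mul J_simps Y matrix_mult_minus matrix_mul_assoc)
  have skew: "X $ i $ j = - X $ j $ i" if "transpose X = - X" for X :: "complex^4^4" and i j
    using arg_cong[OF that, of "\<lambda>X. X $ j $ i"] by (simp add: transpose_def)
  have "pairing A Y = (\<Sum>\<alpha>\<in>UNIV. \<Sum>\<beta>\<in>UNIV. A $ \<alpha> $ \<beta> * Z $ \<beta> $ \<alpha>)"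
    by (simp only: pairing_components Z_def)
  also have "\<dots> = - (\<Sum>\<alpha>\<in>UNIV. \<Sum>\<beta>\<in>UNIV. Z $ \<alpha> $ \<beta> * A $ \<alpha> $ \<beta>)"
    by (subst skew[OF Z]) (simp add: sum_negf mult.commute)
  finally show "(\<Sum>\<alpha>\<in>UNIV. \<Sum>\<beta>\<in>UNIV. (J ** Y ** J) $ \<alpha> $ \<beta> * (A $ \<alpha> $ \<beta> * B $ \<mu> $ \<nu>))
      = - pairing A Y * B $ \<mu> $ \<nu>"
    unfolding Z_def[symmetric] by (simp add: sum_distrib_left sum_distrib_right mult_ac)
  have "A ** J ** Y ** J ** B = A ** Z ** transpose (transpose B)"
    by (simp add: Z_def matrix_mul_assoc)
  then have "(A ** J ** Y ** J ** B) $ \<mu> $ \<nu>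
      = (\<Sum>\<alpha>\<in>UNIV. \<Sum>\<beta>\<in>UNIV. A $ \<mu> $ \<alpha> * transpose B $ \<nu> $ \<beta> * Z $ \<alpha> $ \<beta>)"
    by (simp only: congruence_nth)
  also have "\<dots> = (\<Sum>\<alpha>\<in>UNIV. \<Sum>\<beta>\<in>UNIV. Z $ \<alpha> $ \<beta> * (A $ \<alpha> $ \<mu> * B $ \<nu> $ \<beta>))"
    by (subst skew[OF A, of \<mu>]) (simp add: B mult_ac)
  finally show "(\<Sum>\<alpha>\<in>UNIV. \<Sum>\<beta>\<in>UNIV. (J ** Y ** J) $ \<alpha> $ \<beta> * (A $ \<alpha> $ \<mu> * B $ \<nu> $ \<beta>))
      = (A ** J ** Y ** J ** B) $ \<mu> $ \<nu>"
    unfolding Z_def ..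
  have "B ** J ** Y ** J ** A = B ** Z ** transpose (transpose A)"
    by (simp add: Z_def matrix_mul_assoc)
  then have "(B ** J ** Y ** J ** A) $ \<mu> $ \<nu>
      = (\<Sum>\<beta>\<in>UNIV. \<Sum>\<alpha>\<in>UNIV. B $ \<mu> $ \<beta> * transpose A $ \<nu> $ \<alpha> * Z $ \<beta> $ \<alpha>)"
    by (simp only: congruence_nth)
  also have "\<dots> = (\<Sum>\<beta>\<in>UNIV. \<Sum>\<alpha>\<in>UNIV. Z $ \<alpha> $ \<beta> * (A $ \<alpha> $ \<nu> * B $ \<beta> $ \<mu>))"
  proof (intro sum.cong refl)
    fix \<alpha> \<beta>
    show "B $ \<mu> $ \<beta> * transpose A $ \<nu> $ \<alpha> * Z $ \<beta> $ \<alpha> = Z $ \<alpha> $ \<beta> * (A $ \<alpha> $ \<nu> * B $ \<beta> $ \<mu>)"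
      using skew[OF B, of \<mu> \<beta>] skew[OF Z, of \<beta> \<alpha>] by (simp add: transpose_def)
  qed
  also have "\<dots> = (\<Sum>\<alpha>\<in>UNIV. \<Sum>\<beta>\<in>UNIV. Z $ \<alpha> $ \<beta> * (A $ \<alpha> $ \<nu> * B $ \<beta> $ \<mu>))"
    by (rule sum.swap)
  finally show "(\<Sum>\<alpha>\<in>UNIV. \<Sum>\<beta>\<in>UNIV. (J ** Y ** J) $ \<alpha> $ \<beta> * (A $ \<alpha> $ \<nu> * B $ \<beta> $ \<mu>))
      = (B ** J ** Y ** J ** A) $ \<mu> $ \<nu>"
    unfolding Z_def ..
qed

text \<open>
  The contribution of \<open>A \<otimes> B\<close> to the contraction of the cyclic identity with \<open>U 1\<close> over the first two
  indices; any member of the frame would do.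
\<close>

definition bianchi_term :: "complex^4^4 \<Rightarrow> complex^4^4 \<Rightarrow> complex^4^4" where
  "bianchi_term A B = cscale (- pairing A (U 1)) B + A ** J ** U 1 ** J ** B + B ** J ** U 1 ** J ** A"

lemma bianchi_contraction:
  fixes A B :: "3 \<Rightarrow> complex^4^4"
  assumes "\<And>i. transpose (A i) = - A i"
  shows "(\<Sum>\<alpha>\<in>UNIV. \<Sum>\<beta>\<in>UNIV. (J ** U 1 ** J) $ \<alpha> $ \<beta> *
      ((\<Sum>i\<in>UNIV. \<Sum>j\<in>UNIV. c i j * A i $ \<alpha> $ \<beta> * A j $ \<mu> $ \<nu>)
      + (\<Sum>i\<in>UNIV. \<Sum>j\<in>UNIV. c i j * A i $ \<alpha> $ \<mu> * A j $ \<nu> $ \<beta>)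
      + (\<Sum>i\<in>UNIV. \<Sum>j\<in>UNIV. c i j * A i $ \<alpha> $ \<nu> * A j $ \<beta> $ \<mu>)))
    = (\<Sum>i\<in>UNIV. \<Sum>j\<in>UNIV. cscale (c i j) (bianchi_term (A i) (A j))) $ \<mu> $ \<nu>"
    (is "?l = ?r")
proof -
  let ?Z = "J ** U 1 ** J"
  have "?l = (\<Sum>\<alpha>\<in>UNIV. \<Sum>\<beta>\<in>UNIV. \<Sum>i\<in>UNIV. \<Sum>j\<in>UNIV. c i j * (?Z $ \<alpha> $ \<beta> * (A i $ \<alpha> $ \<beta> * A j $ \<mu> $ \<nu>)
      + ?Z $ \<alpha> $ \<beta> * (A i $ \<alpha> $ \<mu> * A j $ \<nu> $ \<beta>) + ?Z $ \<alpha> $ \<beta> * (A i $ \<alpha> $ \<nu> * A j $ \<beta> $ \<mu>)))"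
    by (simp only: sum_distrib_left distrib_left sum.distrib mult_ac)
  also have "\<dots> = (\<Sum>i\<in>UNIV. \<Sum>j\<in>UNIV. \<Sum>\<alpha>\<in>UNIV. \<Sum>\<beta>\<in>UNIV. c i j * (?Z $ \<alpha> $ \<beta> * (A i $ \<alpha> $ \<beta> * A j $ \<mu> $ \<nu>)
      + ?Z $ \<alpha> $ \<beta> * (A i $ \<alpha> $ \<mu> * A j $ \<nu> $ \<beta>) + ?Z $ \<alpha> $ \<beta> * (A i $ \<alpha> $ \<nu> * A j $ \<beta> $ \<mu>)))"
    by (rule sum_swap_pairs)
  also have "\<dots> = ?r"
    by (simp only: sum.distrib bianchi_products[OF assms assms U_skew] bianchi_term_def
        sum_component vector_add_component cscale_nth flip: sum_distrib_left)
  finally show ?thesis .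
qed

text \<open>For frame members the diagonal value is -4 + 1 + 1 at index 1 and 0 - 1 - 1 elsewhere,
  so it is -2 throughout. For conjugates the pairing with \<open>U 1\<close> vanishes and 1 + 1
  remains. Only the opposite signs matter afterwards.\<close>

lemma bianchi_term_trace:
  "trace (bianchi_term (U i) (U j) ** J ** u 1)
    = (if i = j then - 2 else 0)"
  "trace (bianchi_term (conj_tensor (U i)) (conj_tensor (U j)) ** J ** u 1) = (if i = j then 2 else 0)"
proof -
  have *: "trace (bianchi_term A B ** J ** u 1) = - pairing A (U 1) * pairing B (U 1)
      + trace (A ** J ** u 1 ** (B ** J ** u 1)) + trace (B ** J ** u 1 ** (A ** J ** u 1))" for A B
    by (simp only: bianchi_term_def matrix_add_mult trace_add cscale_matrix_mult trace_cscale
        pairing_def u_def matrix_mul_assoc)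
  show "trace (bianchi_term (U i) (U j) ** J ** u 1)
      = (if i = j then - 2 else 0)"
    unfolding * u_def[symmetric] trace_uuuu by simp
  show "trace (bianchi_term (conj_tensor (U i)) (conj_tensor (U j)) ** J ** u 1) = (if i = j then 2 else 0)"
    unfolding * v_def[symmetric] trace_vuvu by simp
qed


text \<open>Contracting the cyclic identity twice with \<open>U 1\<close> gives -2 times the first
  trace plus 2 times the second. The Ricci condition controls the sum of the two traces and this
  identity their difference.\<close>

lemma weyl_decomposition_traces:
  assumes W: "weyl_tensor g W"
    and W_eq: "\<And>\<alpha> \<beta> \<mu> \<nu>. complex_of_real (W $ \<alpha> $ \<beta> $ \<mu> $ \<nu>) =
      (\<Sum>i\<in>UNIV. \<Sum>j\<in>UNIV. c i j * U i $ \<alpha> $ \<beta> * U j $ \<mu> $ \<nu>)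
      + (\<Sum>i\<in>UNIV. \<Sum>j\<in>UNIV. d i j * conj_tensor (U i) $ \<alpha> $ \<beta> * conj_tensor (U j) $ \<mu> $ \<nu>)"
  shows "(\<Sum>i\<in>UNIV. c i i) = (\<Sum>i\<in>UNIV. d i i)"
proof -
  let ?Z = "J ** U 1 ** J"
  let ?b = "(\<Sum>i\<in>UNIV. \<Sum>j\<in>UNIV. cscale (c i j) (bianchi_term (U i) (U j)))
    + (\<Sum>i\<in>UNIV. \<Sum>j\<in>UNIV. cscale (d i j) (bianchi_term (conj_tensor (U i)) (conj_tensor (U j))))"
  have "?b $ \<mu> $ \<nu> = 0 $ \<mu> $ \<nu>" for \<mu> \<nu>
  proof -
    have "W $ \<alpha> $ \<beta> $ \<mu> $ \<nu> + W $ \<alpha> $ \<mu> $ \<nu> $ \<beta> + W $ \<alpha> $ \<nu> $ \<beta> $ \<mu> = 0" for \<alpha> \<beta>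
      using W unfolding weyl_tensor_def by blast
    from arg_cong[OF this, of complex_of_real]
    have "complex_of_real (W $ \<alpha> $ \<beta> $ \<mu> $ \<nu>) + complex_of_real (W $ \<alpha> $ \<mu> $ \<nu> $ \<beta>)
        + complex_of_real (W $ \<alpha> $ \<nu> $ \<beta> $ \<mu>) = 0" for \<alpha> \<beta>
      by (simp only: of_real_add of_real_0)
    then have "0 = (\<Sum>\<alpha>\<in>UNIV. \<Sum>\<beta>\<in>UNIV. ?Z $ \<alpha> $ \<beta> * (complex_of_real (W $ \<alpha> $ \<beta> $ \<mu> $ \<nu>)
        + complex_of_real (W $ \<alpha> $ \<mu> $ \<nu> $ \<beta>) + complex_of_real (W $ \<alpha> $ \<nu> $ \<beta> $ \<mu>)))"
      by (simp only:) simp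
    also have "\<dots> = ?b $ \<mu> $ \<nu>"
      unfolding vector_add_component bianchi_contraction[OF U_skew, symmetric]
        bianchi_contraction[of "\<lambda>i. conj_tensor (U i)", OF conj_U_skew, symmetric] W_eq
      by (simp only: sum.distrib[symmetric] distrib_left[symmetric] add_ac)
    finally show ?thesis by simp
  qed
  then have "?b = 0" by (intro iffD2[OF vec_eq_iff] allI)
  from arg_cong[OF this, of "\<lambda>X. trace (X ** J ** u 1)"]
  have "(\<Sum>i\<in>UNIV. \<Sum>j\<in>UNIV. c i j * (if i = j then - 2 else 0))
      + (\<Sum>i\<in>UNIV. \<Sum>j\<in>UNIV. d i j * (if i = j then 2 else 0)) = trace (0 ** J ** u 1)"
    by (simp only: matrix_add_mult matrix_mult_sum_left cscale_matrix_mult trace_add trace_sum trace_cscale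
        bianchi_term_trace)
  also have "trace (0 ** J ** u 1) = 0" by (simp only: trace_zero matrix_zero_mult)
  finally show ?thesis
    by (simp add: sum_negf if_distrib[where f = "(*) _"] cong: if_cong flip: sum_distrib_right)
qed

text \<open>For frozen last indices the dual acts on the first pair as on a bivector, with
  eigenvalue \<open>\<i>\<close> on the frame and \<open>- \<i>\<close> on its conjugate.\<close>

lemma dual_weyl_eq:
  assumes "\<And>\<alpha> \<beta> \<mu> \<nu>. complex_of_real (W $ \<alpha> $ \<beta> $ \<mu> $ \<nu>) =
      (\<Sum>i\<in>UNIV. \<Sum>j\<in>UNIV. c i j * U i $ \<alpha> $ \<beta> * U j $ \<mu> $ \<nu>)
      + (\<Sum>i\<in>UNIV. \<Sum>j\<in>UNIV. d i j * conj_tensor (U i) $ \<alpha> $ \<beta> * conj_tensor (U j) $ \<mu> $ \<nu>)"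
  shows "complex_of_real (dual_weyl g W $ \<alpha> $ \<beta> $ \<mu> $ \<nu>) =
      \<i> * (\<Sum>i\<in>UNIV. \<Sum>j\<in>UNIV. c i j * U i $ \<alpha> $ \<beta> * U j $ \<mu> $ \<nu>)
      - \<i> * (\<Sum>i\<in>UNIV. \<Sum>j\<in>UNIV. d i j * conj_tensor (U i) $ \<alpha> $ \<beta> * conj_tensor (U j) $ \<mu> $ \<nu>)"
proof -
  let ?S = "\<chi> \<alpha> \<beta>. complex_of_real (W $ \<alpha> $ \<beta> $ \<mu> $ \<nu>)"
  have "complex_of_real (dual_weyl g W $ \<alpha> $ \<beta> $ \<mu> $ \<nu>) = dual_bivector g ?S $ \<alpha> $ \<beta>"
    by (simp add: dual_weyl_def dual_bivector_def raise_indices_def sum_distrib_left mult_ac)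
  also have "?S = (\<Sum>i\<in>UNIV. \<Sum>j\<in>UNIV. cscale (c i j * U j $ \<mu> $ \<nu>) (U i))
      + (\<Sum>i\<in>UNIV. \<Sum>j\<in>UNIV. cscale (d i j * conj_tensor (U j) $ \<mu> $ \<nu>) (conj_tensor (U i)))"
    by (simp add: vec_eq_iff assms mult_ac)
  also have "dual_bivector g \<dots> $ \<alpha> $ \<beta>
      = (\<Sum>i\<in>UNIV. \<Sum>j\<in>UNIV. (c i j * U j $ \<mu> $ \<nu>) * (\<i> * U i $ \<alpha> $ \<beta>))
      + (\<Sum>i\<in>UNIV. \<Sum>j\<in>UNIV. (d i j * conj_tensor (U j) $ \<mu> $ \<nu>) * (- \<i> * conj_tensor (U i) $ \<alpha> $ \<beta>))"
    by (simp only: dual_bivector_linear dual_bivector_sum U_dual conj_U_dual vector_add_component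
        sum_component cscale_nth)
  finally show ?thesis by (simp add: sum_distrib_left sum_negf mult_ac)
qed

lemma sd_weyl_expansion:
  assumes "weyl_tensor g W"
  obtains c where
    "\<And>\<alpha> \<beta> \<mu> \<nu>. sd_weyl g W $ \<alpha> $ \<beta> $ \<mu> $ \<nu> = (\<Sum>i\<in>UNIV. \<Sum>j\<in>UNIV. c i j * U i $ \<alpha> $ \<beta> * U j $ \<mu> $ \<nu>)"
    "(\<Sum>i\<in>UNIV. c i i) = 0"
proof -
  obtain c d where W: "\<And>\<alpha> \<beta> \<mu> \<nu>. complex_of_real (W $ \<alpha> $ \<beta> $ \<mu> $ \<nu>) =
      (\<Sum>i\<in>UNIV. \<Sum>j\<in>UNIV. c i j * U i $ \<alpha> $ \<beta> * U j $ \<mu> $ \<nu>)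
      + (\<Sum>i\<in>UNIV. \<Sum>j\<in>UNIV. d i j * conj_tensor (U i) $ \<alpha> $ \<beta> * conj_tensor (U j) $ \<mu> $ \<nu>)"
    and trace: "(\<Sum>i\<in>UNIV. c i i) + (\<Sum>i\<in>UNIV. d i i) = 0"
    by (rule weyl_decomposition[OF assms]) (rule that)
  \<comment> \<open>The combination defining \<open>sd_weyl\<close> is the projection onto the
    self-dual part.\<close>
  have sd: "1/2 * (x + y - \<i> * (\<i> * x - \<i> * y)) = x" for x y :: complex
    by (simp add: algebra_simps)
  have "sd_weyl g W $ \<alpha> $ \<beta> $ \<mu> $ \<nu> = (\<Sum>i\<in>UNIV. \<Sum>j\<in>UNIV. c i j * U i $ \<alpha> $ \<beta> * U j $ \<mu> $ \<nu>)" for \<alpha> \<beta> \<mu> \<nu>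
    unfolding sd_weyl_def vec_lambda_beta dual_weyl_eq[OF W] unfolding W by (rule sd)
  moreover have "(\<Sum>i\<in>UNIV. c i i) = 0"
    using trace weyl_decomposition_traces[OF assms W] by simp
  ultimately show thesis using that by blast
qed

text \<open>Skewness and the norm 2 make \<open>U i \<otimes> U j\<close> send \<open>U k\<close> to
  -2 \<open>U i\<close> if \<open>j = k\<close> and to 0 otherwise, and the factor 1/2 in
  \<open>weyl_map\<close> leaves minus the coefficient. Comparison with the eigenvalue equation
  through the pairing makes the coefficient matrix diagonal with entries \<open>- \<rho> i\<close>;
  its trace is zero.\<close>

lemma sd_weyl_eigenframe:
  assumes W: "weyl_tensor g W" and eigen: "\<And>i. weyl_map g W (U i) = cscale (\<rho> i) (U i)"
  shows sd_weyl_eigenframe_nth: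
      "sd_weyl g W $ \<alpha> $ \<beta> $ \<mu> $ \<nu> = - (\<Sum>i\<in>UNIV. \<rho> i * U i $ \<alpha> $ \<beta> * U i $ \<mu> $ \<nu>)"
    and eigenvalues_sum: "(\<Sum>i\<in>UNIV. \<rho> i) = 0"
proof -
  obtain c where sd: "\<And>\<alpha> \<beta> \<mu> \<nu>. sd_weyl g W $ \<alpha> $ \<beta> $ \<mu> $ \<nu> = (\<Sum>i\<in>UNIV. \<Sum>j\<in>UNIV. c i j * U i $ \<alpha> $ \<beta> * U j $ \<mu> $ \<nu>)"
    and trace: "(\<Sum>i\<in>UNIV. c i i) = 0"
    using sd_weyl_expansion[OF W] by blast
  have "contract g (sd_weyl g W) A = (\<Sum>i\<in>UNIV. \<Sum>j\<in>UNIV. cscale (c i j) (contract g (tensor_prod (U i) (U j)) A))" for A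
    unfolding vec_eq_iff
  proof (intro allI)
    fix a b
    have "contract g (sd_weyl g W) A $ a $ b = (\<Sum>m\<in>UNIV. \<Sum>n\<in>UNIV. \<Sum>i\<in>UNIV. \<Sum>j\<in>UNIV.
        c i j * (U i $ a $ b * U j $ m $ n * (J ** A ** J) $ m $ n))"
      by (simp add: contract_components sd sum_distrib_left sum_distrib_right mult_ac)
    also have "\<dots> = (\<Sum>i\<in>UNIV. \<Sum>j\<in>UNIV. \<Sum>m\<in>UNIV. \<Sum>n\<in>UNIV.
        c i j * (U i $ a $ b * U j $ m $ n * (J ** A ** J) $ m $ n))"
      by (rule sum_swap_pairs)
    finally show "contract g (sd_weyl g W) A $ a $ b
        = (\<Sum>i\<in>UNIV. \<Sum>j\<in>UNIV. cscale (c i j) (contract g (tensor_prod (U i) (U j)) A)) $ a $ b"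
      by (simp add: contract_components tensor_prod_def sum_distrib_left)
  qed
  then have "contract g (sd_weyl g W) (U k)
      = (\<Sum>i\<in>UNIV. \<Sum>j\<in>UNIV. if j = k then cscale (- 2 * c i k) (U i) else 0)" for k
    by (simp only: contract_tensor_prod U_skew pairing_minus pairing_frame)
      (intro sum.cong refl, simp add: mult.commute)
  then have contract: "contract g (sd_weyl g W) (U k) = (\<Sum>i\<in>UNIV. cscale (- 2 * c i k) (U i))" for k
    by simp
  have c: "c l k = (if l = k then - \<rho> k else 0)" for l k
  proof -
    have "\<rho> k * pairing (U k) (U l) = (\<Sum>i\<in>UNIV. - c i k * pairing (U i) (U l))"
      using arg_cong[OF eigen[of k], of "\<lambda>X. pairing X (U l)"]
      unfolding weyl_map_def contract pairing_linear pairing_sum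
      by (simp add: sum_distrib_left)
    then have "\<rho> k * (if k = l then 2 else 0) = - 2 * c l k"
      by (simp add: if_distrib[where f = "(*) _"] cong: if_cong)
    then show ?thesis by (auto split: if_splits)
  qed
  show "sd_weyl g W $ \<alpha> $ \<beta> $ \<mu> $ \<nu> = - (\<Sum>i\<in>UNIV. \<rho> i * U i $ \<alpha> $ \<beta> * U i $ \<mu> $ \<nu>)"
    unfolding sd c sum_negf[symmetric]
    by (intro sum.cong refl) (simp add: if_distrib[where f = "\<lambda>x. x * _"] cong: if_cong)
  show "(\<Sum>i\<in>UNIV. \<rho> i) = 0" using trace by (simp add: c sum_negf)
qed

section \<open>The Bel-Robinson tensor\<close>

text \<open>One contraction links \<open>U i\<close> to a conjugate \<open>U j\<close> in the first
  index pair, the other does so in the second, so the sum factors into two frame products. The minus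
  signs of the Weyl expansion and of its conjugate cancel.\<close>

lemma bel_robinson_eigenframe:
  assumes W: "weyl_tensor g W" and eigen: "\<And>i. weyl_map g W (U i) = cscale (\<rho> i) (U i)"
  shows "bel_robinson g W $ \<alpha> $ \<mu> $ \<beta> $ \<nu>
    = (\<Sum>i\<in>UNIV. \<Sum>j\<in>UNIV. \<rho> i * cnj (\<rho> j) * frame_prod i j $ \<alpha> $ \<mu> * frame_prod i j $ \<beta> $ \<nu>)"
proof -
  have skew: "cnj (U j $ x $ y) = - conj_tensor (U j) $ y $ x" for j x y
    using arg_cong[OF conj_U_skew[of j], of "\<lambda>X. X $ y $ x"] by (simp add: transpose_def)
  \<comment> \<open>The Bel-Robinson contraction meets the second index of the conjugate bivector,
    the frame product its first; the resulting sign occurs twice and cancels.\<close>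
  have prod: "frame_prod i j $ x $ y = (\<Sum>k\<in>UNIV. \<Sum>r\<in>UNIV. - (U i $ x $ k * J $ k $ r * cnj (U j $ y $ r)))" for i j x y
    unfolding skew by (simp add: tensor_dot_def)
  have "bel_robinson g W $ \<alpha> $ \<mu> $ \<beta> $ \<nu> = (\<Sum>k\<in>UNIV. \<Sum>t\<in>UNIV. \<Sum>r\<in>UNIV. \<Sum>s\<in>UNIV. \<Sum>i\<in>UNIV. \<Sum>j\<in>UNIV.
      \<rho> i * cnj (\<rho> j) * ((U i $ \<alpha> $ k * J $ k $ r * cnj (U j $ \<mu> $ r)) * (U i $ \<beta> $ t * J $ t $ s * cnj (U j $ \<nu> $ s))))"
    unfolding bel_robinson_def vec_lambda_beta sd_weyl_eigenframe_nth[OF W eigen]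
    by (simp add: sum_distrib_left sum_distrib_right sum_negf mult_ac)
  also have "\<dots> = (\<Sum>i\<in>UNIV. \<Sum>j\<in>UNIV. \<Sum>k\<in>UNIV. \<Sum>t\<in>UNIV. \<Sum>r\<in>UNIV. \<Sum>s\<in>UNIV.
      \<rho> i * cnj (\<rho> j) * ((U i $ \<alpha> $ k * J $ k $ r * cnj (U j $ \<mu> $ r)) * (U i $ \<beta> $ t * J $ t $ s * cnj (U j $ \<nu> $ s))))"
    by (subst (2) sum_swap_pairs, subst sum_swap_pairs) (rule refl)
  also have "\<dots> = (\<Sum>i\<in>UNIV. \<Sum>j\<in>UNIV. \<rho> i * cnj (\<rho> j) * (
      (\<Sum>k\<in>UNIV. \<Sum>r\<in>UNIV. U i $ \<alpha> $ k * J $ k $ r * cnj (U j $ \<mu> $ r)) *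
      (\<Sum>t\<in>UNIV. \<Sum>s\<in>UNIV. U i $ \<beta> $ t * J $ t $ s * cnj (U j $ \<nu> $ s))))"
  proof (intro sum.cong refl)
    fix i j
    let ?f = "\<lambda>k r. U i $ \<alpha> $ k * J $ k $ r * cnj (U j $ \<mu> $ r)"
    let ?h = "\<lambda>t s. U i $ \<beta> $ t * J $ t $ s * cnj (U j $ \<nu> $ s)"
    have "(\<Sum>k\<in>UNIV. \<Sum>t\<in>UNIV. \<Sum>r\<in>UNIV. \<Sum>s\<in>UNIV. \<rho> i * cnj (\<rho> j) * (?f k r * ?h t s))
        = (\<Sum>k\<in>UNIV. \<Sum>r\<in>UNIV. \<Sum>t\<in>UNIV. \<Sum>s\<in>UNIV. \<rho> i * cnj (\<rho> j) * (?f k r * ?h t s))"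
      by (intro sum.cong refl sum.swap)
    also have "\<dots> = \<rho> i * cnj (\<rho> j) * ((\<Sum>k\<in>UNIV. sum (?f k) UNIV) * (\<Sum>t\<in>UNIV. sum (?h t) UNIV))"
      by (simp only: sum_distrib_right) (simp only: sum_distrib_left)
    finally show "(\<Sum>k\<in>UNIV. \<Sum>t\<in>UNIV. \<Sum>r\<in>UNIV. \<Sum>s\<in>UNIV. \<rho> i * cnj (\<rho> j) * (?f k r * ?h t s))
        = \<rho> i * cnj (\<rho> j) * ((\<Sum>k\<in>UNIV. sum (?f k) UNIV) * (\<Sum>t\<in>UNIV. sum (?h t) UNIV))" .
  qed
  finally show ?thesis by (simp add: prod sum_negf mult.assoc)
qed

lemma contract_linear:
  "contract g X (A + B) = contract g X A + contract g X B"
  "contract g X (cscale c A) = cscale c (contract g X A)"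
  by (simp_all add: vec_eq_iff contract_components matrix_add_ldistrib matrix_add_mult cscale_matrix_mult
      distrib_left sum.distrib sum_distrib_left mult_ac)

lemma br_eigenspace_subspace: "ctensor.subspace (br_eigenspace g W c)"
proof -
  have "A + B \<in> br_eigenspace g W c" if "A \<in> br_eigenspace g W c" "B \<in> br_eigenspace g W c" for A B
    using that by (simp add: br_eigenspace_def traceless_symmetric_def transpose_add contract_linear
        distrib_left sum.distrib ctensor.scale_right_distrib)
  moreover have "cscale x A \<in> br_eigenspace g W c" if "A \<in> br_eigenspace g W c" for x A
  proof -
    have "(\<Sum>\<alpha>\<in>UNIV. \<Sum>\<beta>\<in>UNIV. of_real (matrix_inv g $ \<alpha> $ \<beta>) * (x * A $ \<alpha> $ \<beta>))
        = x * (\<Sum>\<alpha>\<in>UNIV. \<Sum>\<beta>\<in>UNIV. of_real (matrix_inv g $ \<alpha> $ \<beta>) * A $ \<alpha> $ \<beta>)"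
      by (simp add: sum_distrib_left mult_ac)
    with that show ?thesis
      by (simp add: br_eigenspace_def traceless_symmetric_def transpose_cscale contract_linear mult.commute)
  qed
  moreover have "0 \<in> br_eigenspace g W c"
    by (simp add: br_eigenspace_def traceless_symmetric_def vec_eq_iff transpose_def contract_def raise_indices_def)
  ultimately show ?thesis by (simp add: ctensor.subspace_def)
qed

text \<open>Frame products are orthonormal for the pairing, so pairing a relation with one of them
  isolates its coefficient.\<close>

lemma independent_frame_prods: "ctensor.independent ((\<lambda>(i, j). frame_prod i j) ` I)"
  and inj_frame_prod: "inj_on (\<lambda>(i, j). frame_prod i j) I"
proof -
  let ?P = "\<lambda>(i, j). frame_prod i j"
  have orthonormal: "pairing (?P p) (?P q) = (if p = q then 1 else 0)" for p q
    by (cases p; cases q) simp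
  show inj: "inj_on ?P I"
    by (rule inj_onI) (metis orthonormal zero_neq_one)
  show "ctensor.independent (?P ` I)"
  proof (rule ctensor.independent_if_scalars_zero)
    fix f x assume f: "(\<Sum>x\<in>?P ` I. cscale (f x) x) = 0" and "x \<in> ?P ` I"
    then obtain q where q: "q \<in> I" "x = ?P q" by blast
    have "(\<Sum>p\<in>I. cscale (f (?P p)) (?P p)) = 0"
      using f by (simp add: sum.reindex[OF inj] o_def)
    from arg_cong[OF this, of "\<lambda>A. pairing A (?P q)"]
    have "(\<Sum>p\<in>I. f (?P p) * (if p = q then 1 else 0)) = 0"
      unfolding pairing_sum pairing_linear orthonormal
      by (simp add: pairing_def matrix_zero_mult trace_zero)
    then show "f x = 0" using q by (simp add: if_distrib[where f = "(*) _"] cong: if_cong)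
  qed simp
qed

lemma contract_bel_robinson:
  assumes "weyl_tensor g W" and "\<And>i. weyl_map g W (U i) = cscale (\<rho> i) (U i)"
  shows "contract g (bel_robinson g W) A
    = (\<Sum>i\<in>UNIV. \<Sum>j\<in>UNIV. cscale (\<rho> i * cnj (\<rho> j) * pairing A (frame_prod i j)) (frame_prod i j))"
proof -
  have "contract g (bel_robinson g W) A = (\<Sum>i\<in>UNIV. \<Sum>j\<in>UNIV.
      cscale (\<rho> i * cnj (\<rho> j)) (contract g (tensor_prod (frame_prod i j) (frame_prod i j)) A))"
    unfolding vec_eq_iff
  proof (intro allI)
    fix a b
    have "contract g (bel_robinson g W) A $ a $ b = (\<Sum>m\<in>UNIV. \<Sum>n\<in>UNIV. \<Sum>i\<in>UNIV. \<Sum>j\<in>UNIV.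
        \<rho> i * cnj (\<rho> j) * (frame_prod i j $ a $ b * frame_prod i j $ m $ n * (J ** A ** J) $ m $ n))"
      by (simp add: contract_components bel_robinson_eigenframe[OF assms] sum_distrib_left
          sum_distrib_right mult_ac)
    also have "\<dots> = (\<Sum>i\<in>UNIV. \<Sum>j\<in>UNIV. \<Sum>m\<in>UNIV. \<Sum>n\<in>UNIV.
        \<rho> i * cnj (\<rho> j) * (frame_prod i j $ a $ b * frame_prod i j $ m $ n * (J ** A ** J) $ m $ n))"
      by (rule sum_swap_pairs)
    finally show "contract g (bel_robinson g W) A $ a $ b = (\<Sum>i\<in>UNIV. \<Sum>j\<in>UNIV.
        cscale (\<rho> i * cnj (\<rho> j)) (contract g (tensor_prod (frame_prod i j) (frame_prod i j)) A)) $ a $ b"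
      by (simp add: contract_components tensor_prod_def sum_distrib_left)
  qed
  then show ?thesis
    by (simp add: contract_tensor_prod frame_prod_sym pairing_sym[of "frame_prod _ _"] mult_ac)
qed

text \<open>The Bel-Robinson tensor multiplies the component along \<open>frame_prod i j\<close> by
  \<open>\<rho> i * cnj (\<rho> j)\<close>. In an eigenvector for \<open>c\<close>, a component
  whose factor differs from \<open>c\<close> must vanish.\<close>

lemma br_eigenspace_frame_prods:
  assumes "weyl_tensor g W" and "\<And>i. weyl_map g W (U i) = cscale (\<rho> i) (U i)"
  defines "I \<equiv> \<lambda>c. {(i, j). \<rho> i * cnj (\<rho> j) = c}"
  shows br_eigenspace_eq_span:
      "br_eigenspace g W c = ctensor.span ((\<lambda>(i, j). frame_prod i j) ` I c)"
    and dim_br_eigenspace: "ctensor.dim (br_eigenspace g W c) = card (I c)"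
proof -
  let ?S = "ctensor.span ((\<lambda>(i, j). frame_prod i j) ` I c)"
  note T = contract_bel_robinson[OF assms(1,2)]
  have T_pairing: "pairing (contract g (bel_robinson g W) A) (frame_prod k l)
      = \<rho> k * cnj (\<rho> l) * pairing A (frame_prod k l)" for A k l
  proof -
    have "pairing (contract g (bel_robinson g W) A) (frame_prod k l) = (\<Sum>i\<in>UNIV. \<Sum>j\<in>UNIV.
        if i = k then if j = l then \<rho> k * cnj (\<rho> l) * pairing A (frame_prod k l) else 0 else 0)"
      unfolding T pairing_sum pairing_linear pairing_frame by (intro sum.cong refl) simp
    also have "\<dots> = (\<Sum>i\<in>UNIV. if i = k then \<rho> k * cnj (\<rho> l) * pairing A (frame_prod k l) else 0)"
      by (intro sum.cong refl) simp
    finally show ?thesis by simp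
  qed
  show eq: "br_eigenspace g W c = ?S"
  proof (rule antisym)
    show "br_eigenspace g W c \<subseteq> ?S"
    proof
      fix A assume A: "A \<in> br_eigenspace g W c"
      have "cscale (pairing A (frame_prod i j)) (frame_prod i j) \<in> ?S" for i j
      proof (cases "(i, j) \<in> I c")
        case True
        then show ?thesis
          by (intro ctensor.span_scale[OF ctensor.span_base] image_eqI[of _ _ "(i, j)"]) simp_all
      next
        case False
        have "\<rho> i * cnj (\<rho> j) * pairing A (frame_prod i j) = c * pairing A (frame_prod i j)"
          using A T_pairing[of A i j] by (auto simp: br_eigenspace_def pairing_linear)
        then have "pairing A (frame_prod i j) = 0" using False by (auto simp: I_def)
        then show ?thesis by (simp add: ctensor.span_zero)
      qed
      then have "(\<Sum>i\<in>UNIV. \<Sum>j\<in>UNIV. cscale (pairing A (frame_prod i j)) (frame_prod i j)) \<in> ?S"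
        by (intro ctensor.span_sum)
      moreover have "A = (\<Sum>i\<in>UNIV. \<Sum>j\<in>UNIV. cscale (pairing A (frame_prod i j)) (frame_prod i j))"
        using A by (intro traceless_symmetric_expansion) (simp add: br_eigenspace_def)
      ultimately show "A \<in> ?S" by metis
    qed
    have "frame_prod i j \<in> br_eigenspace g W c" if "(i, j) \<in> I c" for i j
    proof -
      have "contract g (bel_robinson g W) (frame_prod i j)
          = (\<Sum>k\<in>UNIV. \<Sum>l\<in>UNIV. if k = i then if l = j then cscale c (frame_prod i j) else 0 else 0)"
        unfolding T pairing_frame using that by (intro sum.cong refl) (auto simp: I_def)
      also have "\<dots> = (\<Sum>k\<in>UNIV. if k = i then cscale c (frame_prod i j) else 0)"
        by (intro sum.cong refl) simp
      finally show ?thesis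
        by (simp add: br_eigenspace_def frame_prod_traceless_symmetric)
    qed
    then show "?S \<subseteq> br_eigenspace g W c"
      by (intro ctensor.span_minimal br_eigenspace_subspace) auto
  qed
  show "ctensor.dim (br_eigenspace g W c) = card (I c)"
    unfolding eq ctensor.dim_span_eq_card_independent[OF independent_frame_prods]
    by (rule card_image[OF inj_frame_prod])
qed

end

section \<open>Type IM: one vanishing eigenvalue\<close>

text \<open>
  For the zero map the sum in \<open>trace_on\<close> vanishes whatever basis the choice operator returns, so
  basis independence of the trace is not an issue.
\<close>

lemma type_IM_infinity_sd_weyl_nonzero:
  assumes "type_IM_infinity g W"
  shows "sd_weyl g W \<noteq> 0"
proof
  assume "sd_weyl g W = 0"
  then have "weyl_map g W F = 0" for F
    by (simp add: weyl_map_def contract_def vec_eq_iff)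
  then have "weyl_map g W ^^ 2 = (\<lambda>F. 0)" by (simp add: fun_eq_iff numeral_2_eq_2)
  then have "trace_on S (weyl_map g W ^^ 2) = 0" for S
    by (simp add: trace_on_def Let_def ctensor.representation_zero)
  with assms show False by (simp add: type_IM_infinity_def)
qed

theorem proposition6:
  fixes g :: "real^4^4" and W :: "real^4^4^4^4"
    and \<rho> :: "3 \<Rightarrow> complex" and U :: "3 \<Rightarrow> complex^4^4"
    and t :: real and P :: "3 \<Rightarrow> 3 \<Rightarrow> complex^4^4"
  assumes "lorentzian g"
    and "weyl_tensor g W"
    and "type_IM_infinity g W"
    and "orthonormal_sd_frame g U"
    and "\<And>i. weyl_map g W (U i) = cscale (\<rho> i) (U i)"
    and "\<rho> 1 = 0"
    and "t = (cmod (\<rho> 2))\<^sup>2"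
    and "\<And>j k. P j k = tensor_dot g (U j) (conj_tensor (U k))"
  shows "sd_weyl g W = - (\<Sum>i\<in>UNIV. tensor_prod (cscale (\<rho> i) (U i)) (U i)) \<and>
    t = (cmod (\<rho> 3))\<^sup>2 \<and>
    bel_robinson g W =
      t *\<^sub>R (tensor_prod (P 2 2) (P 2 2) + tensor_prod (P 3 3) (P 3 3)
         - tensor_prod (P 2 3) (P 2 3) - tensor_prod (P 3 2) (P 3 2)) \<and>
    br_eigenspace g W (of_real t) = ctensor.span {P 2 2, P 3 3} \<and>
    ctensor.dim (br_eigenspace g W (of_real t)) = 2 \<and>
    br_eigenspace g W (- of_real t) = ctensor.span {P 2 3, P 3 2} \<and>
    ctensor.dim (br_eigenspace g W (- of_real t)) = 2 \<and>
    br_eigenspace g W 0 = ctensor.span {P 1 1, P 1 2, P 2 1, P 1 3, P 3 1} \<and>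
    ctensor.dim (br_eigenspace g W 0) = 5"
proof -
  note W = assms(2) and eigen = assms(5) and \<rho>1 = assms(6)
  interpret sd_frame g U
    using assms(1,4) by unfold_locales
  have P: "P = (\<lambda>j k. frame_prod j k)" using assms(8) by (simp add: fun_eq_iff)
  have sd: "sd_weyl g W = - (\<Sum>i\<in>UNIV. tensor_prod (cscale (\<rho> i) (U i)) (U i))"
    by (simp add: vec_eq_iff tensor_prod_def sd_weyl_eigenframe_nth[OF W eigen])
  have "\<rho> 2 + \<rho> 3 = 0" using eigenvalues_sum[OF W eigen] \<rho>1 by (simp add: sum_3)
  then have \<rho>3: "\<rho> 3 = - \<rho> 2" by (simp add: eq_neg_iff_add_eq_0 add.commute)
  \<comment> \<open>Otherwise all three eigenvalues would vanish and the self-dual Weyl tensor with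
    them, contradicting the nonzero trace of the square.\<close>
  have \<rho>2: "\<rho> 2 \<noteq> 0"
  proof
    assume "\<rho> 2 = 0"
    then have "sd_weyl g W = 0" by (simp add: sd sum_3 \<rho>1 \<rho>3 vec_eq_iff tensor_prod_def)
    then show False using type_IM_infinity_sd_weyl_nonzero[OF assms(3)] by simp
  qed
  then have t: "t \<noteq> 0" by (simp add: assms(7))
  have \<rho>_products: "\<rho> 2 * cnj (\<rho> 2) = of_real t"
    by (simp only: assms(7) complex_norm_square)
  have br: "bel_robinson g W =
      t *\<^sub>R (tensor_prod (P 2 2) (P 2 2) + tensor_prod (P 3 3) (P 3 3)
         - tensor_prod (P 2 3) (P 2 3) - tensor_prod (P 3 2) (P 3 2))"
    by (simp add: vec_eq_iff bel_robinson_eigenframe[OF W eigen] sum_3 \<rho>1 \<rho>3 P tensor_prod_def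
        scaleR_conv_of_real[where 'a = complex] algebra_simps flip: \<rho>_products)
  have neq: "of_real t \<noteq> - complex_of_real t" "- complex_of_real t \<noteq> of_real t"
    using t by (simp_all add: eq_neg_iff_add_eq_0 neg_eq_iff_add_eq_0 flip: of_real_add)
  \<comment> \<open>With \<open>\<rho> 1 = 0\<close> and \<open>\<rho> 3 = - \<rho> 2\<close>, the
    nine products are \<open>t\<close> twice, \<open>- t\<close> twice and 0 five times; these
    values are distinct because \<open>t\<close> is nonzero.\<close>
  have plus: "{(i, j). \<rho> i * cnj (\<rho> j) = of_real t} = {(2, 2), (3, 3)}"
    and minus: "{(i, j). \<rho> i * cnj (\<rho> j) = - of_real t} = {(2, 3), (3, 2)}"
    and zero: "{(i, j). \<rho> i * cnj (\<rho> j) = 0} = {(1, 1), (1, 2), (2, 1), (1, 3), (3, 1)}"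
    by (auto simp: set_eq_iff forall_3 \<rho>1 \<rho>2 \<rho>3 \<rho>_products t neq)
  note span = br_eigenspace_eq_span[OF W eigen] and dim = dim_br_eigenspace[OF W eigen]
  have "br_eigenspace g W (of_real t) = ctensor.span {P 2 2, P 3 3}"
    "br_eigenspace g W (- of_real t) = ctensor.span {P 2 3, P 3 2}"
    "br_eigenspace g W 0 = ctensor.span {P 1 1, P 1 2, P 2 1, P 1 3, P 3 1}"
    by (simp_all only: span plus minus zero P image_insert image_empty prod.case)
  moreover have "ctensor.dim (br_eigenspace g W (of_real t)) = 2"
    "ctensor.dim (br_eigenspace g W (- of_real t)) = 2"
    "ctensor.dim (br_eigenspace g W 0) = 5"
    by (simp_all only: dim plus minus zero) simp_all
  ultimately show ?thesis using sd br by (simp add: \<rho>3 assms(7))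
qed

end
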